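(* With the notation and standing assumptions of the context (in particular $\mathbb{F}$ has characteristic $0$, the Lie algebra $({\cal A}_4,[\cdot,\cdot]_2)$ is built from $\Gamma,\varphi_1,\dots,\varphi_4,{\cal J}_1,\dots,{\cal J}_4,\alpha_0$, and ${\cal B}_4={\cal A}_4/\mathbb{F}x^{\sigma,\vec 0}$), consider the following condition on an element $\rho\in\Gamma$: $$( * )\qquad \varphi_1(\rho-\alpha_0)=\varphi_2(\rho-\alpha_0)=\varphi_3(\rho+2\alpha_0)=\varphi_4(\rho+2\alpha_0)=0 .$$ (a) If $\vec{\cal J}\neq\{\vec 0\}$ or there does not exist $\rho\in\Gamma$ satisfying $( * )$, then the Lie algebra $({\cal B}_4,[\cdot,\cdot]_2)$ is simple. (b) If $\vec{\cal J}=\{\vec 0\}$ and there exists $\rho\in\Gamma$ satisfying $( * )$ (such $\rho$ is then unique), then ${\cal B}_4^{(1)}=[{\cal B}_4,{\cal B}_4]_2$ is a simple Lie algebra and $${\cal B}_4={\cal B}_4^{(1)}\oplus(\mathbb{F}x^{\rho,\vec 0}+\mathbb{F}x^{\sigma,\vec 0})$$ as vector spaces, where the elements $x^{\rho,\vec 0},x^{\sigma,\vec 0}$ on the right-hand side denote their images in the quotient ${\cal B}_4$ (so the image of $x^{\sigma,\vec 0}$ is $0$).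
   Context: $\mathbb{F}$ is a field of characteristic $0$, all vector spaces are over $\mathbb{F}$, and $\mathbb{N}=\{0,1,2,\dots\}$. Let $\Gamma$ be a torsion-free abelian group. For $p\in\{1,2,3,4\}$ let ${\cal J}_p\in\{\{0\},\mathbb{N}\}$ (i.e. ${\cal J}_p$ is either $\{0\}$ or $\mathbb{N}$), and let $\varphi_p:\Gamma\to\mathbb{F}$ be additive group homomorphisms such that - $\varphi_p\not\equiv 0$ whenever ${\cal J}_p=\{0\}$, for $p=1,2,3,4$; - $\bigcap_{p=1}^4\ker\varphi_p=\{0\}$; - for every $p\in\{1,2,3,4\}$, $\Big(\bigcap_{q\in\{1,2,3,4\},\,q\neq p}\ker\varphi_q\Big)\setminus\ker\varphi_p\neq\emptyset$. Fix an element $\alpha_0\in\Gamma\setminus\big[(\ker\varphi_1\cap\ker\varphi_2)\cup(\ker\varphi_3\cap\ker\varphi_4)\big]$ such that $$\varphi_p(\alpha_0)\in\varphi_p(\ker\varphi_3\cap\ker\varphi_4)\ \ (p=1,2),\qquad \varphi_q(\alpha_0)\in\varphi_q(\ker\varphi_1\cap\ker\varphi_2)\ \ (q=3,4).$$ Put $\vec{\cal J}={\cal J}_1\times{\cal J}_2\times{\cal J}_3\times{\cal J}_4$ with componentwise addition, write $\vec i=(i_1,i_2,i_3,i_4)$ and $\vec 0=(0,0,0,0)$, and let $1_{[p]}$ be the vector with $1$ in position $p$ and $0$ elsewhere. Let ${\cal A}_4$ be the vector space with basis $\{x^{\alpha,\vec i}\mid(\alpha,\vec i)\in\Gamma\times\vec{\cal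 J}\}$. It is a commutative associative algebra with product $x^{\alpha,\vec i}\cdot x^{\beta,\vec j}=x^{\alpha+\beta,\vec i+\vec j}$ and identity $1=x^{0,\vec 0}$. For $p=1,2,3,4$ let $\partial_p$ be the derivation of ${\cal A}_4$ given by $$\partial_p(x^{\alpha,\vec i})=\varphi_p(\alpha)x^{\alpha,\vec i}+i_p\,x^{\alpha,\vec i-1_{[p]}},$$ where a symbol $x^{\alpha,\vec l}$ with $\vec l\notin\vec{\cal J}$ is treated as zero. Define, for $u,v\in{\cal A}_4$, $$[u,v]_2=x^{\alpha_0,\vec 0}\big(\partial_1(u)\partial_2(v)-\partial_1(v)\partial_2(u)\big)+\big(\partial_3(u)\partial_4(v)-\partial_3(v)\partial_4(u)\big)+\varphi_3(\alpha_0)\big(u\,\partial_4(v)-\partial_4(u)\,v\big)-\varphi_4(\alpha_0)\big(u\,\partial_3(v)-\partial_3(u)\,v\big).$$ Then $({\cal A}_4,[\cdot,\cdot]_2)$ is a Lie algebra. $\sigma$ denotes the element of $\ker\varphi_1\cap\ker\varphi_2$ with $\varphi_3(\sigma+\alpha_0)=\varphi_4(\sigma+\alpha_0)=0$, if such an element exists; it is then unique because $\bigcap_{p=1}^4\ker\varphi_p=\{0\}$. If $\sigma$ does not exist, $x^{\sigma,\vec 0}$ is understood to be $0\in{\cal A}_4$. If $\sigma$ exists, $x^{\sigma,\vec 0}$ is central in $({\cal A}_4,[\cdot,\cdot]_2)$. Let ${\cal B}_4={\cal A}_4/\mathbb{F}x^{\sigma,\vec 0}$ be the quotient Lie algebra,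 with induced bracket still denoted $[\cdot,\cdot]_2$. *)

theory Defs
  imports
    "HOL-Analysis.Finite_Cartesian_Product"
    "HOL-Library.Numeral_Type"
    "HOL-Library.Poly_Mapping"
    "HOL-Library.Product_Plus"
    "HOL-Algebra.QuotRing"
    "HOL-Algebra.Module"
    "HOL-Algebra.Algebraic_Closure_Type"
begin

section \<open>Lie algebras\<close>

text \<open>
  A Lie algebra over \<open>R\<close> is carried by a module record whose multiplication is the Lie bracket:
  \<open>x \<otimes>\<^bsub>L\<^esub> y\<close> is \<open>[x, y]\<close>. The locale \<^locale>\<open>module\<close> puts no condition on the fields
  \<^const>\<open>monoid.mult\<close> and \<^const>\<open>one\<close> of \<open>L\<close>; the field \<^const>\<open>one\<close> has no meaning here.
\<close>

locale lie_algebra = R?: field R + module R L for R and L (structure) +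
  assumes bracket_closed:
      "\<lbrakk>x \<in> carrier L; y \<in> carrier L\<rbrakk> \<Longrightarrow> x \<otimes>\<^bsub>L\<^esub> y \<in> carrier L"
    and bracket_add_left:
      "\<lbrakk>x \<in> carrier L; y \<in> carrier L; z \<in> carrier L\<rbrakk> \<Longrightarrow>
       (x \<oplus>\<^bsub>L\<^esub> y) \<otimes>\<^bsub>L\<^esub> z = x \<otimes>\<^bsub>L\<^esub> z \<oplus>\<^bsub>L\<^esub> y \<otimes>\<^bsub>L\<^esub> z"
    and bracket_add_right:
      "\<lbrakk>x \<in> carrier L; y \<in> carrier L; z \<in> carrier L\<rbrakk> \<Longrightarrow>
       x \<otimes>\<^bsub>L\<^esub> (y \<oplus>\<^bsub>L\<^esub> z) = x \<otimes>\<^bsub>L\<^esub> y \<oplus>\<^bsub>L\<^esub> x \<otimes>\<^bsub>L\<^esub> z"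
    and bracket_smult_left:
      "\<lbrakk>a \<in> carrier R; x \<in> carrier L; y \<in> carrier L\<rbrakk> \<Longrightarrow>
       (a \<odot>\<^bsub>L\<^esub> x) \<otimes>\<^bsub>L\<^esub> y = a \<odot>\<^bsub>L\<^esub> (x \<otimes>\<^bsub>L\<^esub> y)"
    and bracket_smult_right:
      "\<lbrakk>a \<in> carrier R; x \<in> carrier L; y \<in> carrier L\<rbrakk> \<Longrightarrow>
       x \<otimes>\<^bsub>L\<^esub> (a \<odot>\<^bsub>L\<^esub> y) = a \<odot>\<^bsub>L\<^esub> (x \<otimes>\<^bsub>L\<^esub> y)"
    and bracket_self: "x \<in> carrier L \<Longrightarrow> x \<otimes>\<^bsub>L\<^esub> x = \<zero>\<^bsub>L\<^esub>"
    and jacobi: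
      "\<lbrakk>x \<in> carrier L; y \<in> carrier L; z \<in> carrier L\<rbrakk> \<Longrightarrow>
       x \<otimes>\<^bsub>L\<^esub> (y \<otimes>\<^bsub>L\<^esub> z) \<oplus>\<^bsub>L\<^esub> y \<otimes>\<^bsub>L\<^esub> (z \<otimes>\<^bsub>L\<^esub> x) \<oplus>\<^bsub>L\<^esub> z \<otimes>\<^bsub>L\<^esub> (x \<otimes>\<^bsub>L\<^esub> y) = \<zero>\<^bsub>L\<^esub>"

definition lie_ideal :: "('a, 'c) ring_scheme \<Rightarrow> ('a, 'b, 'd) module_scheme \<Rightarrow> 'b set \<Rightarrow> bool"
  where "lie_ideal R L I \<longleftrightarrow>
    submodule I R L \<and> (\<forall>x\<in>carrier L. \<forall>y\<in>I. x \<otimes>\<^bsub>L\<^esub> y \<in> I)"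

definition simple_lie_algebra :: "('a, 'c) ring_scheme \<Rightarrow> ('a, 'b, 'd) module_scheme \<Rightarrow> bool"
  where "simple_lie_algebra R L \<longleftrightarrow>
    lie_algebra R L \<and>
    (\<exists>x\<in>carrier L. \<exists>y\<in>carrier L. x \<otimes>\<^bsub>L\<^esub> y \<noteq> \<zero>\<^bsub>L\<^esub>) \<and>
    (\<forall>I. lie_ideal R L I \<longrightarrow> I = {\<zero>\<^bsub>L\<^esub>} \<or> I = carrier L)"

text \<open>The linear span of all brackets. The derived algebra is \<open>L\<lparr>carrier := derived_space R L\<rparr>\<close>.\<close>

definition derived_space :: "('a, 'c) ring_scheme \<Rightarrow> ('a, 'b, 'd) module_scheme \<Rightarrow> 'b set"
  where "derived_space R L =
    (\<lambda>H. submodule H R L) hull {x \<otimes>\<^bsub>L\<^esub> y | x y. x \<in> carrier L \<and> y \<in> carrier L}"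

abbreviation derived_algebra ::
    "('a, 'c) ring_scheme \<Rightarrow> ('a, 'b, 'd) module_scheme \<Rightarrow> ('a, 'b, 'd) module_scheme"
  where "derived_algebra R L \<equiv> L\<lparr>carrier := derived_space R L\<rparr>"

text \<open>
  The structure on cosets follows \<^const>\<open>FactRing\<close>. If \<open>I\<close> is an ideal, the unions reduce to
  \<open>[x + I, y + I] = [x, y] + I\<close> and \<open>a (x + I) = a x + I\<close>.
\<close>

definition lie_quotient :: "('a, 'b, 'd) module_scheme \<Rightarrow> 'b set \<Rightarrow> ('a, 'b set) module"
  where "lie_quotient L I =
    \<lparr>carrier = a_rcosets\<^bsub>L\<^esub> I, monoid.mult = rcoset_mult L I, one = I +>\<^bsub>L\<^esub> \<one>\<^bsub>L\<^esub>,
     zero = I, add = set_add L, module.smult = (\<lambda>a A. \<Union>x\<in>A. I +>\<^bsub>L\<^esub> (a \<odot>\<^bsub>L\<^esub> x))\<rparr>"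

definition line :: "('a, 'c) ring_scheme \<Rightarrow> ('a, 'b, 'd) module_scheme \<Rightarrow> 'b \<Rightarrow> 'b set"
  where "line R L x = {a \<odot>\<^bsub>L\<^esub> x | a. a \<in> carrier R}"

definition is_direct_sum ::
    "('a, 'c) ring_scheme \<Rightarrow> ('a, 'b, 'd) module_scheme \<Rightarrow> 'b set \<Rightarrow> 'b set \<Rightarrow> bool"
  where "is_direct_sum R L U W \<longleftrightarrow>
    submodule U R L \<and> submodule W R L \<and> U <+>\<^bsub>L\<^esub> W = carrier L \<and> U \<inter> W = {\<zero>\<^bsub>L\<^esub>}"


section \<open>The algebra \<open>A\<^sub>4\<close>\<close>

text \<open>
  The index set \<open>{1,2,3,4}\<close> is the numeral type \<open>4\<close>, in which the numeral \<open>4\<close> is another name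
  for \<open>0\<close>; so \<open>UNIV = {1,2,3,4}\<close>. The element \<open>\<Sum> c\<^bsub>\<alpha>,i\<^esub> x\<^bsup>\<alpha>,i\<^esup>\<close> is the finitely supported
  function \<open>(\<alpha>, i) \<mapsto> c\<^bsub>\<alpha>,i\<^esub>\<close>, and the product of \<^typ>\<open>('g \<times> (nat ^ 4)) \<Rightarrow>\<^sub>0 'f\<close> is the convolution
  \<open>x\<^bsup>\<alpha>,i\<^esup> \<cdot> x\<^bsup>\<beta>,j\<^esup> = x\<^bsup>\<alpha>+\<beta>,i+j\<^esup>\<close>. The sets \<open>J p\<close> enter through the carrier of \<open>A\<^sub>4\<close>.
\<close>

type_synonym ('g, 'f) galg = "('g \<times> (nat ^ 4)) \<Rightarrow>\<^sub>0 'f"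

definition torsion_free :: "'g::ab_group_add itself \<Rightarrow> bool"
  where "torsion_free _ \<longleftrightarrow> (\<forall>(\<gamma>::'g) n::nat. n > 0 \<longrightarrow> (\<Sum>k<n. \<gamma>) = 0 \<longrightarrow> \<gamma> = 0)"

definition ker :: "('g \<Rightarrow> 'f::zero) \<Rightarrow> 'g set"
  where "ker f = {\<gamma>. f \<gamma> = 0}"

definition vecJ :: "(4 \<Rightarrow> nat set) \<Rightarrow> (nat ^ 4) set"
  where "vecJ J = {i. \<forall>p. i $ p \<in> J p}"

abbreviation xmon :: "'g \<Rightarrow> nat ^ 4 \<Rightarrow> ('g, 'f::zero_neq_one) galg"
  where "xmon \<alpha> i \<equiv> Poly_Mapping.single (\<alpha>, i) 1"

definition scale :: "'f::mult_zero \<Rightarrow> ('g, 'f) galg \<Rightarrow> ('g, 'f) galg"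
  where "scale c u = Poly_Mapping.map ((*) c) u"

text \<open>
  The truncated difference \<open>i - 1\<^bsub>[p]\<^esub>\<close> is wrong only if \<open>i\<^sub>p = 0\<close>, where its coefficient vanishes.
  If \<open>J p = {0}\<close>, then \<open>i\<^sub>p = 0\<close> throughout the carrier of \<open>A\<^sub>4\<close>.
\<close>

definition partial :: "(4 \<Rightarrow> 'g \<Rightarrow> 'f::field) \<Rightarrow> 4 \<Rightarrow> ('g, 'f) galg \<Rightarrow> ('g, 'f) galg"
  where "partial \<phi> p u =
    (\<Sum>(\<alpha>, i)\<in>Poly_Mapping.keys u. scale (Poly_Mapping.lookup u (\<alpha>, i))
       (scale (\<phi> p \<alpha>) (xmon \<alpha> i) + scale (of_nat (i $ p)) (xmon \<alpha> (i - axis p 1))))"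

lemma partial_xmon:
  "partial \<phi> p (xmon \<alpha> i) =
     scale (\<phi> p \<alpha>) (xmon \<alpha> i) + scale (of_nat (i $ p)) (xmon \<alpha> (i - axis p 1))"
  by (simp add: partial_def scale_def) (simp add: poly_mapping_eq_iff map.rep_eq fun_eq_iff when_def)

definition bracket2 ::
    "(4 \<Rightarrow> 'g::ab_group_add \<Rightarrow> 'f::field) \<Rightarrow> 'g \<Rightarrow> ('g, 'f) galg \<Rightarrow> ('g, 'f) galg \<Rightarrow> ('g, 'f) galg"
  where "bracket2 \<phi> \<alpha>\<^sub>0 u v =
    (let D = partial \<phi> in
      xmon \<alpha>\<^sub>0 0 * (D 1 u * D 2 v - D 1 v * D 2 u)
      + (D 3 u * D 4 v - D 3 v * D 4 u)
      + scale (\<phi> 3 \<alpha>\<^sub>0) (u * D 4 v - D 4 u * v)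
      - scale (\<phi> 4 \<alpha>\<^sub>0) (u * D 3 v - D 3 u * v))"

definition A4 ::
    "(4 \<Rightarrow> nat set) \<Rightarrow> (4 \<Rightarrow> 'g::ab_group_add \<Rightarrow> 'f::field) \<Rightarrow> 'g \<Rightarrow> ('f, ('g, 'f) galg) module"
  where "A4 J \<phi> \<alpha>\<^sub>0 =
    \<lparr>carrier = {u. Poly_Mapping.keys u \<subseteq> UNIV \<times> vecJ J}, monoid.mult = bracket2 \<phi> \<alpha>\<^sub>0, one = undefined,
     zero = 0, add = (+), module.smult = scale\<rparr>"


section \<open>The quotient \<open>B\<^sub>4\<close>\<close>

definition is_sigma :: "(4 \<Rightarrow> 'g::ab_group_add \<Rightarrow> 'f::field) \<Rightarrow> 'g \<Rightarrow> 'g \<Rightarrow> bool"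
  where "is_sigma \<phi> \<alpha>\<^sub>0 \<sigma> \<longleftrightarrow>
    \<sigma> \<in> ker (\<phi> 1) \<inter> ker (\<phi> 2) \<and> \<phi> 3 (\<sigma> + \<alpha>\<^sub>0) = 0 \<and> \<phi> 4 (\<sigma> + \<alpha>\<^sub>0) = 0"

definition x_sigma :: "(4 \<Rightarrow> 'g::ab_group_add \<Rightarrow> 'f::field) \<Rightarrow> 'g \<Rightarrow> ('g, 'f) galg"
  where "x_sigma \<phi> \<alpha>\<^sub>0 =
    (if \<exists>\<sigma>. is_sigma \<phi> \<alpha>\<^sub>0 \<sigma> then xmon (THE \<sigma>. is_sigma \<phi> \<alpha>\<^sub>0 \<sigma>) 0 else 0)"

definition F_sigma ::
    "(4 \<Rightarrow> nat set) \<Rightarrow> (4 \<Rightarrow> 'g::ab_group_add \<Rightarrow> 'f::field) \<Rightarrow> 'g \<Rightarrow> ('g, 'f) galg set"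
  where "F_sigma J \<phi> \<alpha>\<^sub>0 = line ring_of_type_algebra (A4 J \<phi> \<alpha>\<^sub>0) (x_sigma \<phi> \<alpha>\<^sub>0)"

definition B4 ::
    "(4 \<Rightarrow> nat set) \<Rightarrow> (4 \<Rightarrow> 'g::ab_group_add \<Rightarrow> 'f::field) \<Rightarrow> 'g \<Rightarrow> ('f, ('g, 'f) galg set) module"
  where "B4 J \<phi> \<alpha>\<^sub>0 = lie_quotient (A4 J \<phi> \<alpha>\<^sub>0) (F_sigma J \<phi> \<alpha>\<^sub>0)"

definition toB4 ::
    "(4 \<Rightarrow> nat set) \<Rightarrow> (4 \<Rightarrow> 'g::ab_group_add \<Rightarrow> 'f::field) \<Rightarrow> 'g \<Rightarrow> ('g, 'f) galg \<Rightarrow> ('g, 'f) galg set"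
  where "toB4 J \<phi> \<alpha>\<^sub>0 u = F_sigma J \<phi> \<alpha>\<^sub>0 +>\<^bsub>A4 J \<phi> \<alpha>\<^sub>0\<^esub> u"

definition star_cond :: "(4 \<Rightarrow> 'g::ab_group_add \<Rightarrow> 'f::field) \<Rightarrow> 'g \<Rightarrow> 'g \<Rightarrow> bool"
  where "star_cond \<phi> \<alpha>\<^sub>0 \<rho> \<longleftrightarrow>
    \<phi> 1 (\<rho> - \<alpha>\<^sub>0) = 0 \<and> \<phi> 2 (\<rho> - \<alpha>\<^sub>0) = 0 \<and>
    \<phi> 3 (\<rho> + (\<alpha>\<^sub>0 + \<alpha>\<^sub>0)) = 0 \<and> \<phi> 4 (\<rho> + (\<alpha>\<^sub>0 + \<alpha>\<^sub>0)) = 0"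

end

theory Submission
  imports Defs "HOL-Analysis.Cartesian_Space"
begin

text \<open>
  Put \<open>t = x\<^bsup>\<alpha>\<^sub>0,0\<^esup>\<close>, \<open>E\<^sub>p = \<partial>\<^sub>p\<close> for \<open>p = 1, 2\<close> and \<open>E\<^sub>p = \<partial>\<^sub>p + \<phi>\<^sub>p(\<alpha>\<^sub>0)\<close> for \<open>p = 3, 4\<close>. Then
  \<open>[u, v] = t (E\<^sub>1 u E\<^sub>2 v - E\<^sub>1 v E\<^sub>2 u) + (E\<^sub>3 u E\<^sub>4 v - E\<^sub>3 v E\<^sub>4 u)\<close>, and the joint kernel of the \<open>E\<^sub>p\<close> is
  \<open>F x\<^bsup>\<sigma>,0\<^esup>\<close>.

  Let \<open>I\<close> be an ideal and \<open>u \<in> I\<close> outside this kernel. Bracketing \<open>u\<close> with a suitable \<open>x\<^bsup>\<alpha>,0\<^esup>\<close> gives a nonzero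
  \<open>v \<in> I\<close> whose weights avoid finitely many bad values of each \<open>\<phi>\<^sub>p\<close>. Products of operators
  \<open>ad x\<^bsup>k\<gamma>\<^esup>\<close> of total degree \<open>0\<close> show that \<open>q\<^sub>p\<close> and \<open>E\<^sub>p q\<^sub>p\<close> preserve \<open>I\<close>, where \<open>q\<^sub>p = E\<^sub>p (E\<^sub>p - c\<^sub>p)\<close> for a
  constant \<open>c\<^sub>p\<close>, hence so does every \<open>E\<^sub>p\<^sup>n q\<^sub>p\<close>. As \<open>q\<^sub>p\<close> is injective on the good weights and the
  \<open>\<partial>\<^sub>p\<close> are locally finite, \<open>I\<close> contains a joint eigenvector, that is a monomial \<open>x\<^bsup>\<tau>,0\<^esup>\<close>.
  Then \<open>x\<^bsup>\<kappa>,0\<^esup> \<in> I\<close> for many \<open>\<kappa>\<close>, and differences of brackets with these yield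
  \<open>(\<partial>\<^sub>p + d\<^sub>p) A\<^sub>4 \<subseteq> I\<close> for all \<open>p\<close>, with \<open>d = (-\<phi>\<^sub>1(\<alpha>\<^sub>0), -\<phi>\<^sub>2(\<alpha>\<^sub>0), 2\<phi>\<^sub>3(\<alpha>\<^sub>0), 2\<phi>\<^sub>4(\<alpha>\<^sub>0))\<close>. The sum of these
  images is \<open>A\<^sub>4\<close>, unless all \<open>J\<^sub>p = {0}\<close> and \<open>\<rho>\<close> exists; then it misses just \<open>x\<^bsup>\<rho>,0\<^esup>\<close>.
\<close>

section \<open>Derivations of \<open>A\<^sub>4\<close>\<close>

lemma scale_eq: "scale c u = Poly_Mapping.single 0 c * u"
  for u :: "('g::ab_group_add, 'f::comm_ring_1) galg"
  by (simp add: scale_def mult_map_scale_conv_mult)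

lemma lookup_scale: "Poly_Mapping.lookup (scale c u) k = c * Poly_Mapping.lookup u k"
  for u :: "('g, 'f::mult_zero) galg"
  by (simp add: scale_def map.rep_eq when_def)

lemma scale_zero_left [simp]: "scale 0 u = (0 :: ('g, 'f::mult_zero) galg)"
  by (rule poly_mapping_eqI) (simp add: lookup_scale)

lemma scale_zero_right [simp]: "scale c 0 = (0 :: ('g, 'f::mult_zero) galg)"
  by (rule poly_mapping_eqI) (simp add: lookup_scale)

lemma scale_one [simp]: "scale 1 u = (u :: ('g, 'f::comm_ring_1) galg)"
  by (rule poly_mapping_eqI) (simp add: lookup_scale)

lemma scale_minus_one: "scale (-1) u = (- u :: ('g, 'f::comm_ring_1) galg)"
  by (rule poly_mapping_eqI) (simp add: lookup_scale)

lemma scale_uminus: "scale c (- u) = - scale c u"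
  for u :: "('g, 'f::ring) galg"
  by (rule poly_mapping_eqI) (simp add: lookup_scale)

lemma scale_uminus_left: "scale (- c) u = - scale c u"
  for u :: "('g, 'f::ring) galg"
  by (rule poly_mapping_eqI) (simp add: lookup_scale)

lemma scale_add_right: "scale c (u + v) = scale c u + (scale c v :: ('g, 'f::ring) galg)"
  by (rule poly_mapping_eqI) (simp add: lookup_scale lookup_add algebra_simps)

lemma scale_add_left: "scale (a + b) u = scale a u + (scale b u :: ('g, 'f::ring) galg)"
  by (rule poly_mapping_eqI) (simp add: lookup_scale lookup_add algebra_simps)

lemma scale_diff_right: "scale c (u - v) = scale c u - (scale c v :: ('g, 'f::ring) galg)"
  by (rule poly_mapping_eqI) (simp add: lookup_scale lookup_minus algebra_simps)

lemma scale_diff_left: "scale (a - b) u = scale a u - (scale b u :: ('g, 'f::ring) galg)"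
  by (rule poly_mapping_eqI) (simp add: lookup_scale lookup_minus algebra_simps)

lemma scale_scale: "scale a (scale b u) = scale (a * b) u"
  for u :: "('g, 'f::comm_ring_1) galg"
  by (rule poly_mapping_eqI) (simp add: lookup_scale mult.assoc)

lemma scale_eq_0_iff: "scale c u = 0 \<longleftrightarrow> c = 0 \<or> u = (0 :: ('g, 'f::field) galg)"
  by (auto simp: poly_mapping_eq_iff fun_eq_iff lookup_scale)

lemma scale_mult_left: "scale c u * v = scale c (u * v)"
  for u :: "('g::ab_group_add, 'f::comm_ring_1) galg"
  by (simp add: scale_eq mult.assoc)

lemma scale_mult_right: "u * scale c v = scale c (u * v)"
  for u :: "('g::ab_group_add, 'f::comm_ring_1) galg"
  by (simp add: scale_eq mult_ac)

lemma keys_scale_subset: "Poly_Mapping.keys (scale c u) \<subseteq> Poly_Mapping.keys u"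
  for u :: "('g, 'f::mult_zero) galg"
  by (auto simp: in_keys_iff lookup_scale)

lemma galg_sum_monomials:
  "u = (\<Sum>(\<alpha>, i)\<in>Poly_Mapping.keys u. scale (Poly_Mapping.lookup u (\<alpha>, i)) (xmon \<alpha> i))"
  for u :: "('g, 'f::comm_ring_1) galg"
proof (rule poly_mapping_eqI)
  fix k
  have "(\<Sum>(\<alpha>, i)\<in>Poly_Mapping.keys u.
          Poly_Mapping.lookup (scale (Poly_Mapping.lookup u (\<alpha>, i)) (xmon \<alpha> i)) k)
      = (\<Sum>l\<in>Poly_Mapping.keys u. if l = k then Poly_Mapping.lookup u k else 0)"
    by (rule sum.cong) (auto simp: lookup_scale lookup_single when_def)
  also have "\<dots> = Poly_Mapping.lookup u k"
    by (simp add: in_keys_iff)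
  finally show "Poly_Mapping.lookup u k = Poly_Mapping.lookup
      (\<Sum>(\<alpha>, i)\<in>Poly_Mapping.keys u. scale (Poly_Mapping.lookup u (\<alpha>, i)) (xmon \<alpha> i)) k"
    by (simp add: lookup_sum case_prod_beta)
qed

lemma galg_span_induct [consumes 1, case_names zero add scale]:
  fixes u :: "('g, 'f::comm_ring_1) galg"
  assumes "Poly_Mapping.keys u \<subseteq> K"
    and "P 0"
    and add: "\<And>v w. P v \<Longrightarrow> P w \<Longrightarrow> P (v + w)"
    and scale: "\<And>c \<alpha> i. (\<alpha>, i) \<in> K \<Longrightarrow> P (scale c (xmon \<alpha> i))"
  shows "P u"
proof -
  have "P (\<Sum>k\<in>S. scale (Poly_Mapping.lookup u k) (xmon (fst k) (snd k)))"
    if "finite S" "S \<subseteq> K" for S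
    using that
  proof (induction S rule: finite_induct)
    case (insert k S)
    then show ?case
      using scale[of "fst k" "snd k"] by (simp add: add)
  qed (simp add: assms)
  from this[of "Poly_Mapping.keys u"] show ?thesis
    using assms(1) galg_sum_monomials[of u] by (simp add: case_prod_beta)
qed

text \<open>Only the monomial itself and the one whose exponent is higher by one at \<open>p\<close>
  contribute to this coefficient. Linearity, commutation and eigenvector equations thus become
  identities between coefficients.\<close>

lemma lookup_partial:
  "Poly_Mapping.lookup (partial \<phi> p u) (\<beta>, j) =
     \<phi> p \<beta> * Poly_Mapping.lookup u (\<beta>, j)
     + of_nat (Suc (j $ p)) * Poly_Mapping.lookup u (\<beta>, j + axis p 1)"
  (is "_ = ?R")
proof -
  let ?K = "Poly_Mapping.keys u" and ?u = "Poly_Mapping.lookup u"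
  have succ: "j + axis p 1 \<noteq> j"
    by (auto simp: vec_eq_iff axis_def)
  \<comment> \<open>Truncated subtraction can be undone only at a positive entry; at a zero entry
    the factor \<open>of_nat (i $ p)\<close> removes the term.\<close>
  have pred: "i - axis p 1 = j \<longleftrightarrow> i = j + axis p 1" if "i $ p \<noteq> 0" for i :: "nat ^ 4"
    using that by (auto simp: vec_eq_iff axis_def split: if_splits)
  have "Poly_Mapping.lookup (partial \<phi> p u) (\<beta>, j) =
      (\<Sum>k\<in>?K. (if k = (\<beta>, j) then \<phi> p \<beta> * ?u k else 0)
        + (if k = (\<beta>, j + axis p 1) then of_nat (Suc (j $ p)) * ?u k else 0))"
    unfolding partial_def lookup_sum
  proof (rule sum.cong)
    fix k assume "k \<in> ?K"
    obtain \<alpha> i where k: "k = (\<alpha>, i)" by (cases k)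
    show "Poly_Mapping.lookup (case k of (\<alpha>, i) \<Rightarrow> scale (?u (\<alpha>, i)) (scale (\<phi> p \<alpha>) (xmon \<alpha> i)
            + scale (of_nat (i $ p)) (xmon \<alpha> (i - axis p 1)))) (\<beta>, j)
        = (if k = (\<beta>, j) then \<phi> p \<beta> * ?u k else 0)
          + (if k = (\<beta>, j + axis p 1) then of_nat (Suc (j $ p)) * ?u k else 0)"
      using pred[of i] succ
      by (cases "i $ p = 0")
        (auto simp: k lookup_scale lookup_add lookup_single when_def algebra_simps axis_def)
  qed simp
  also have "\<dots> = ?R"
    by (simp add: sum.distrib in_keys_iff)
  finally show ?thesis .
qed

section \<open>Linearity, commutation and the Leibniz rule\<close>

lemma partial_add: "partial \<phi> p (u + v) = partial \<phi> p u + partial \<phi> p v"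
  by (rule poly_mapping_eqI) (auto simp: lookup_partial lookup_add algebra_simps)

lemma partial_scale: "partial \<phi> p (scale c u) = scale c (partial \<phi> p u)"
  by (rule poly_mapping_eqI) (auto simp: lookup_partial lookup_scale algebra_simps)

lemma partial_zero [simp]: "partial \<phi> p 0 = 0"
  by (rule poly_mapping_eqI) (auto simp: lookup_partial)

lemma partial_diff: "partial \<phi> p (u - v) = partial \<phi> p u - partial \<phi> p v"
  by (rule poly_mapping_eqI) (auto simp: lookup_partial lookup_minus algebra_simps)

lemma partial_commute: "partial \<phi> p (partial \<phi> q u) = partial \<phi> q (partial \<phi> p u)"
proof (cases "p = q")
  case False
  then show ?thesis
    by (intro poly_mapping_eqI)
      (auto simp: lookup_partial axis_def algebra_simps add.commute[of "axis p 1"])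
qed simp

lemma xmon_mult: "xmon \<alpha> i * xmon \<beta> j = (xmon (\<alpha> + \<beta>) (i + j) :: ('g::ab_group_add, 'f::comm_ring_1) galg)"
  by (simp add: mult_single)

text \<open>On monomials both the weight and the exponent at \<open>p\<close> add up; two inductions
  over the monomial basis, one for each factor, extend this bilinearly.\<close>

lemma partial_mult:
  fixes u :: "('g::ab_group_add, 'f::field) galg"
  assumes "additive (\<phi> p)"
  shows "partial \<phi> p (u * v) = partial \<phi> p u * v + u * partial \<phi> p v"
proof -
  have pm: "partial \<phi> p (xmon \<alpha> i * xmon \<beta> j)
      = partial \<phi> p (xmon \<alpha> i) * xmon \<beta> j + xmon \<alpha> i * partial \<phi> p (xmon \<beta> j)"
    for \<alpha> \<beta> i j
  proof -
    have i: "i - axis p 1 + j = i + j - axis p 1" if "i $ p \<noteq> 0"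
      using that by (auto simp: vec_eq_iff axis_def)
    have j: "i + (j - axis p 1) = i + j - axis p 1" if "j $ p \<noteq> 0"
      using that by (auto simp: vec_eq_iff axis_def)
    have zero: "scale 0 w = 0" for w :: "('g, 'f) galg"
      by (rule poly_mapping_eqI) (simp add: lookup_scale)
    show ?thesis
      using i j
      by (cases "i $ p = 0"; cases "j $ p = 0")
        (auto simp: partial_xmon xmon_mult algebra_simps scale_mult_left scale_mult_right
          additive.add[OF assms] scale_add_left zero)
  qed
  have "partial \<phi> p (xmon \<alpha> i * v) = partial \<phi> p (xmon \<alpha> i) * v + xmon \<alpha> i * partial \<phi> p v"
    for \<alpha> i
    by (induction v rule: galg_span_induct[OF subset_UNIV])
      (auto simp: algebra_simps partial_add partial_scale scale_mult_left scale_mult_right pm scale_add_right)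
  then show ?thesis
    by (induction u rule: galg_span_induct[OF subset_UNIV])
      (auto simp: algebra_simps partial_add partial_scale scale_mult_left scale_mult_right scale_add_right)
qed

section \<open>Surjections of Lie algebras\<close>

text \<open>Negatives are multiples by the scalar -1, so closure under scalars covers
  inverses.\<close>

lemma (in module) submodule_iff:
  "submodule H R M \<longleftrightarrow> H \<subseteq> carrier M \<and> \<zero>\<^bsub>M\<^esub> \<in> H \<and> (\<forall>x\<in>H. \<forall>y\<in>H. x \<oplus>\<^bsub>M\<^esub> y \<in> H)
     \<and> (\<forall>a\<in>carrier R. \<forall>x\<in>H. a \<odot>\<^bsub>M\<^esub> x \<in> H)" (is "_ \<longleftrightarrow> ?C")
proof
  assume H: "submodule H R M"
  then have "\<zero>\<^bsub>M\<^esub> \<in> H"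
    using subgroup.one_closed[OF submodule.axioms(1)[OF H]] by simp
  then show ?C
    using submoduleE[OF H] by blast
next
  assume C: ?C
  show "submodule H R M"
  proof (rule submoduleI)
    fix x assume x: "x \<in> H"
    have "(\<ominus> \<one>) \<odot>\<^bsub>M\<^esub> x = \<ominus>\<^bsub>M\<^esub> x"
      using C x smult_l_minus[of \<one> x] by auto
    moreover have "(\<ominus> \<one>) \<odot>\<^bsub>M\<^esub> x \<in> H"
      using C x by simp
    ultimately show "\<ominus>\<^bsub>M\<^esub> x \<in> H"
      by simp
  qed (use C in auto)
qed

text \<open>The target starts as a bare record and inherits the Lie algebra axioms along
  \<open>h\<close>. The instances are \<open>quot\<close> on \<open>A4_set\<close> and on
  \<open>derived_set\<close>.\<close>

locale lie_surjection =
  fixes R :: "('a, 'c) ring_scheme" and L :: "('a, 'b, 'd) module_scheme"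
    and L' :: "('a, 'e, 'k) module_scheme" and h :: "'b \<Rightarrow> 'e"
  assumes lie: "lie_algebra R L"
    and carrier: "carrier L' = h ` carrier L"
    and zero: "\<zero>\<^bsub>L'\<^esub> = h \<zero>\<^bsub>L\<^esub>"
    and add: "\<And>x y. \<lbrakk>x \<in> carrier L; y \<in> carrier L\<rbrakk> \<Longrightarrow> h x \<oplus>\<^bsub>L'\<^esub> h y = h (x \<oplus>\<^bsub>L\<^esub> y)"
    and bracket: "\<And>x y. \<lbrakk>x \<in> carrier L; y \<in> carrier L\<rbrakk> \<Longrightarrow> h x \<otimes>\<^bsub>L'\<^esub> h y = h (x \<otimes>\<^bsub>L\<^esub> y)"
    and smult: "\<And>a x. \<lbrakk>a \<in> carrier R; x \<in> carrier L\<rbrakk> \<Longrightarrow> a \<odot>\<^bsub>L'\<^esub> h x = h (a \<odot>\<^bsub>L\<^esub> x)"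
begin

interpretation L: lie_algebra R L by (rule lie)

lemma abelian_group_target: "abelian_group L'"
proof (rule abelian_groupI)
  fix x assume "x \<in> carrier L'"
  then obtain u where u: "u \<in> carrier L" "x = h u"
    by (auto simp: carrier)
  then have "h (\<ominus>\<^bsub>L\<^esub> u) \<oplus>\<^bsub>L'\<^esub> x = \<zero>\<^bsub>L'\<^esub>"
    by (simp add: add zero L.M.l_neg)
  with u show "\<exists>y\<in>carrier L'. y \<oplus>\<^bsub>L'\<^esub> x = \<zero>\<^bsub>L'\<^esub>"
    by (auto simp: carrier)
qed (auto simp: carrier zero add L.M.a_ac)

lemma lie_algebra_target: "lie_algebra R L'"
proof (rule lie_algebra.intro)
  show "field R"
    by (rule L.R.field_axioms)
  show "module R L'"
    by (rule moduleI[OF L.R.is_cring abelian_group_target])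
      (auto simp: carrier add smult L.smult_l_distr L.smult_r_distr L.smult_assoc1)
  show "lie_algebra_axioms R L'"
    by unfold_locales
      (auto simp: carrier add smult bracket zero L.bracket_closed L.bracket_add_left
        L.bracket_add_right L.bracket_smult_left L.bracket_smult_right L.bracket_self L.jacobi)
qed

interpretation L': lie_algebra R L' by (rule lie_algebra_target)

lemma submodule_preimage:
  assumes "submodule K R L'"
  shows "submodule {x \<in> carrier L. h x \<in> K} R L"
  using assms unfolding L'.submodule_iff L.submodule_iff
  by (auto simp: add[symmetric] smult[symmetric] zero[symmetric])

lemma submodule_image:
  assumes "submodule H R L"
  shows "submodule (h ` H) R L'"
  using assms unfolding L'.submodule_iff L.submodule_iff
  by (auto simp: carrier add smult zero subset_iff)

text \<open>The preimage of an ideal is an ideal containing the kernel of \<open>h\<close>, so it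
  suffices to control the ideals above the kernel.\<close>

lemma simple_target:
  assumes ideals: "\<And>I. \<lbrakk>lie_ideal R L I; {x \<in> carrier L. h x = \<zero>\<^bsub>L'\<^esub>} \<subseteq> I\<rbrakk>
      \<Longrightarrow> I \<subseteq> {x \<in> carrier L. h x = \<zero>\<^bsub>L'\<^esub>} \<or> I = carrier L"
    and nonabelian: "x \<in> carrier L" "y \<in> carrier L" "h (x \<otimes>\<^bsub>L\<^esub> y) \<noteq> \<zero>\<^bsub>L'\<^esub>"
  shows "simple_lie_algebra R L'"
  unfolding simple_lie_algebra_def
proof (intro conjI allI impI)
  show "\<exists>x\<in>carrier L'. \<exists>y\<in>carrier L'. x \<otimes>\<^bsub>L'\<^esub> y \<noteq> \<zero>\<^bsub>L'\<^esub>"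
    using nonabelian by (auto simp: carrier bracket)
next
  fix K assume K: "lie_ideal R L' K"
  then have sub: "submodule K R L'"
    by (simp add: lie_ideal_def)
  have K0: "\<zero>\<^bsub>L'\<^esub> \<in> K" and KL: "K \<subseteq> carrier L'"
    using sub unfolding L'.submodule_iff by auto
  define I where "I = {x \<in> carrier L. h x \<in> K}"
  have "x \<otimes>\<^bsub>L\<^esub> y \<in> I" if "x \<in> carrier L" "y \<in> I" for x y
  proof -
    have "h x \<otimes>\<^bsub>L'\<^esub> h y \<in> K"
      using K that by (auto simp: lie_ideal_def I_def carrier)
    with that show ?thesis
      by (simp add: I_def bracket L.bracket_closed)
  qed
  then have "lie_ideal R L I"
    using submodule_preimage[OF sub] by (auto simp: lie_ideal_def I_def)
  moreover have "{x \<in> carrier L. h x = \<zero>\<^bsub>L'\<^esub>} \<subseteq> I"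
    using K0 by (auto simp: I_def)
  ultimately consider "I \<subseteq> {x \<in> carrier L. h x = \<zero>\<^bsub>L'\<^esub>}" | "I = carrier L"
    using ideals by blast
  then show "K = {\<zero>\<^bsub>L'\<^esub>} \<or> K = carrier L'"
  proof cases
    case 1
    then have "K \<subseteq> {\<zero>\<^bsub>L'\<^esub>}"
      using KL by (auto simp: I_def carrier)
    with K0 show ?thesis by blast
  next
    case 2
    then have "carrier L' \<subseteq> K"
      by (auto simp: I_def carrier)
    with KL show ?thesis by blast
  qed
qed (rule lie_algebra_target)

end

section \<open>The Lie bracket\<close>

definition weight_shift :: "(4 \<Rightarrow> 'g \<Rightarrow> 'f::zero) \<Rightarrow> 'g \<Rightarrow> 4 \<Rightarrow> 'f"
  where "weight_shift \<phi> \<alpha>\<^sub>0 p = (if p \<in> {1, 2} then 0 else \<phi> p \<alpha>\<^sub>0)"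

definition shifted_partial ::
    "(4 \<Rightarrow> 'g \<Rightarrow> 'f::field) \<Rightarrow> 'g \<Rightarrow> 4 \<Rightarrow> ('g, 'f) galg \<Rightarrow> ('g, 'f) galg"
  where "shifted_partial \<phi> \<alpha>\<^sub>0 p u = partial \<phi> p u + scale (weight_shift \<phi> \<alpha>\<^sub>0 p) u"

lemma weight_shift_simps [simp]:
  "weight_shift \<phi> \<alpha>\<^sub>0 1 = 0" "weight_shift \<phi> \<alpha>\<^sub>0 2 = 0"
  "weight_shift \<phi> \<alpha>\<^sub>0 3 = \<phi> 3 \<alpha>\<^sub>0" "weight_shift \<phi> \<alpha>\<^sub>0 4 = \<phi> 4 \<alpha>\<^sub>0"
  by (simp_all add: weight_shift_def)

text \<open>Terms carrying both shifts are multiples of \<open>u * v\<close> and cancel by skew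
  symmetry; terms carrying one shift are the last two summands of the definition.\<close>

lemma bracket2_eq:
  "bracket2 \<phi> \<alpha>\<^sub>0 u v =
     xmon \<alpha>\<^sub>0 0 * (partial \<phi> 1 u * partial \<phi> 2 v - partial \<phi> 1 v * partial \<phi> 2 u)
     + (shifted_partial \<phi> \<alpha>\<^sub>0 3 u * shifted_partial \<phi> \<alpha>\<^sub>0 4 v
        - shifted_partial \<phi> \<alpha>\<^sub>0 3 v * shifted_partial \<phi> \<alpha>\<^sub>0 4 u)"
  by (simp add: bracket2_def Let_def shifted_partial_def scale_eq algebra_simps)

lemma partial_const [simp]:
  assumes "additive (\<phi> p)"
  shows "partial \<phi> p (Poly_Mapping.single (0 :: 'g::ab_group_add \<times> (nat ^ 4)) c) = 0"
proof -
  have "Poly_Mapping.single 0 c = scale c (xmon (0 :: 'g) 0)"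
    by (rule poly_mapping_eqI) (simp add: lookup_scale lookup_single when_def zero_prod_def)
  then show ?thesis
    by (simp add: partial_scale partial_xmon additive.zero[OF assms])
qed

lemma partial_xmon_zero: "partial \<phi> p (xmon \<alpha> 0) = scale (\<phi> p \<alpha>) (xmon \<alpha> 0)"
  by (simp add: partial_xmon)

text \<open>The operators commute and each obeys a product rule up to a constant. The three double
  brackets therefore expand into polynomials in iterated images of \<open>u\<close>,
  \<open>v\<close>, \<open>w\<close>, which cancel in the commutative ring.\<close>

lemma bracket2_jacobi:
  fixes u v w :: "('g::ab_group_add, 'f::field) galg"
  assumes additive: "\<And>p. additive (\<phi> p)"
  shows "bracket2 \<phi> \<alpha>\<^sub>0 u (bracket2 \<phi> \<alpha>\<^sub>0 v w) + bracket2 \<phi> \<alpha>\<^sub>0 v (bracket2 \<phi> \<alpha>\<^sub>0 w u)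
    + bracket2 \<phi> \<alpha>\<^sub>0 w (bracket2 \<phi> \<alpha>\<^sub>0 u v) = 0"
proof -
  define D where "D = partial \<phi>"
  define E where "E = shifted_partial \<phi> \<alpha>\<^sub>0"
  define t :: "('g, 'f) galg" where "t = xmon \<alpha>\<^sub>0 0"
  \<comment> \<open>Scalars are embedded as constant elements, so that ring normalisation treats
    them as factors.\<close>
  define a :: "4 \<Rightarrow> ('g, 'f) galg" where "a p = Poly_Mapping.single 0 (\<phi> p \<alpha>\<^sub>0)" for p
  have br: "bracket2 \<phi> \<alpha>\<^sub>0 x y = t * (D 1 x * D 2 y - D 1 y * D 2 x) + (E 3 x * E 4 y - E 3 y * E 4 x)"
    for x y
    by (simp add: bracket2_eq D_def E_def t_def)
  have E: "E p x = D p x + Poly_Mapping.single 0 (weight_shift \<phi> \<alpha>\<^sub>0 p) * x" for p x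
    by (simp add: E_def D_def shifted_partial_def scale_eq)
  note D_simps = partial_add partial_diff partial_mult[OF additive] partial_const[OF additive]
  have D: "D p (x + y) = D p x + D p y" "D p (x - y) = D p x - D p y"
      "D p (x * y) = D p x * y + x * D p y" "D p t = a p * t"
      "D p (Poly_Mapping.single 0 c) = 0" for p x y c
    by (simp_all add: D_def D_simps t_def a_def partial_xmon_zero scale_eq)
  have comm: "D 2 (D 1 x) = D 1 (D 2 x)" "E 4 (E 3 x) = E 3 (E 4 x)" "E q (D p x) = D p (E q x)"
    for p q x
    by (simp_all add: E D partial_commute[of \<phi> 2 1] partial_commute[of \<phi> 4 3]
        partial_commute[of \<phi> p q] D_def D_simps algebra_simps)
  \<comment> \<open>A derivation plus a constant shows the constant once on the left and twice on
    the right, hence the correction term. On \<open>t\<close> the weight and the shift are equal,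
    hence the factor 2.\<close>
  have E3: "E 3 (x + y) = E 3 x + E 3 y" "E 3 (x - y) = E 3 x - E 3 y"
      "E 3 (x * y) = E 3 x * y + x * E 3 y - a 3 * x * y" "E 3 t = 2 * a 3 * t" for x y
    by (simp_all add: E D a_def algebra_simps)
  have E4: "E 4 (x + y) = E 4 x + E 4 y" "E 4 (x - y) = E 4 x - E 4 y"
      "E 4 (x * y) = E 4 x * y + x * E 4 y - a 4 * x * y" "E 4 t = 2 * a 4 * t" for x y
    by (simp_all add: E D a_def algebra_simps)
  show ?thesis
    unfolding br by (simp add: D E3 E4 comm algebra_simps)
qed

text \<open>The record \<open>A4\<close> with its carrier left open, so that the same results serve
  \<open>A4_set\<close> and \<open>derived_set\<close>.\<close>

definition lie_on ::
    "(4 \<Rightarrow> 'g::ab_group_add \<Rightarrow> 'f::field) \<Rightarrow> 'g \<Rightarrow> ('g, 'f) galg set \<Rightarrow> ('f, ('g, 'f) galg) module"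
  where "lie_on \<phi> \<alpha>\<^sub>0 U =
    \<lparr>carrier = U, monoid.mult = bracket2 \<phi> \<alpha>\<^sub>0, one = undefined, zero = 0, add = (+),
     module.smult = scale\<rparr>"

lemma lie_on_sel [simp]:
  "carrier (lie_on \<phi> \<alpha>\<^sub>0 U) = U" "monoid.mult (lie_on \<phi> \<alpha>\<^sub>0 U) = bracket2 \<phi> \<alpha>\<^sub>0"
  "ring.zero (lie_on \<phi> \<alpha>\<^sub>0 U) = 0" "ring.add (lie_on \<phi> \<alpha>\<^sub>0 U) = (+)" "module.smult (lie_on \<phi> \<alpha>\<^sub>0 U) = scale"
  by (simp_all add: lie_on_def)

lemma ring_of_type_algebra_sel [simp]:
  "carrier (ring_of_type_algebra :: 'a::comm_ring_1 ring) = UNIV"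
  "ring.add (ring_of_type_algebra :: 'a ring) = (+)" "ring.zero (ring_of_type_algebra :: 'a ring) = 0"
  "monoid.mult (ring_of_type_algebra :: 'a ring) = (*)" "monoid.one (ring_of_type_algebra :: 'a ring) = 1"
  by (simp_all add: ring_of_type_algebra_def)

definition linear_subspace :: "('g, 'f::comm_ring_1) galg set \<Rightarrow> bool"
  where "linear_subspace U \<longleftrightarrow>
    0 \<in> U \<and> (\<forall>u\<in>U. \<forall>v\<in>U. u + v \<in> U) \<and> (\<forall>c. \<forall>u\<in>U. scale c u \<in> U)"

lemma bracket2_add_left: "bracket2 \<phi> \<alpha>\<^sub>0 (u + v) w = bracket2 \<phi> \<alpha>\<^sub>0 u w + bracket2 \<phi> \<alpha>\<^sub>0 v w"
  by (simp add: bracket2_eq shifted_partial_def partial_add scale_add_right algebra_simps)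

lemma bracket2_skew: "bracket2 \<phi> \<alpha>\<^sub>0 v u = - bracket2 \<phi> \<alpha>\<^sub>0 u v"
  by (simp add: bracket2_eq algebra_simps)

lemma bracket2_self: "bracket2 \<phi> \<alpha>\<^sub>0 u u = 0"
  by (simp add: bracket2_eq)

lemma bracket2_scale_left: "bracket2 \<phi> \<alpha>\<^sub>0 (scale c u) w = scale c (bracket2 \<phi> \<alpha>\<^sub>0 u w)"
  for u :: "('g::ab_group_add, 'f::field) galg"
proof -
  have "shifted_partial \<phi> \<alpha>\<^sub>0 p (scale c u) = scale c (shifted_partial \<phi> \<alpha>\<^sub>0 p u)" for p
    by (simp add: shifted_partial_def partial_scale scale_add_right scale_scale mult.commute)
  then show ?thesis
    by (simp add: bracket2_eq partial_scale) (simp add: scale_eq algebra_simps)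
qed

lemma bracket2_add_right: "bracket2 \<phi> \<alpha>\<^sub>0 w (u + v) = bracket2 \<phi> \<alpha>\<^sub>0 w u + bracket2 \<phi> \<alpha>\<^sub>0 w v"
  by (simp add: bracket2_skew[of \<phi> \<alpha>\<^sub>0 w] bracket2_add_left)

lemma bracket2_scale_right: "bracket2 \<phi> \<alpha>\<^sub>0 w (scale c u) = scale c (bracket2 \<phi> \<alpha>\<^sub>0 w u)"
  for u :: "('g::ab_group_add, 'f::field) galg"
  by (simp add: bracket2_skew[of \<phi> \<alpha>\<^sub>0 w] bracket2_scale_left scale_uminus)

lemma lie_algebra_lie_on:
  fixes \<phi> :: "4 \<Rightarrow> 'g::ab_group_add \<Rightarrow> 'f::field"
  assumes additive: "\<And>p. additive (\<phi> p)"
    and U: "linear_subspace U"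
    and closed: "\<And>u v. u \<in> U \<Longrightarrow> v \<in> U \<Longrightarrow> bracket2 \<phi> \<alpha>\<^sub>0 u v \<in> U"
  shows "lie_algebra ring_of_type_algebra (lie_on \<phi> \<alpha>\<^sub>0 U)"
proof (rule lie_algebra.intro)
  show "field (ring_of_type_algebra :: 'f ring)"
    by (rule field_from_type_algebra)
  have "abelian_group (lie_on \<phi> \<alpha>\<^sub>0 U)"
  proof (rule abelian_groupI)
    fix x assume "x \<in> carrier (lie_on \<phi> \<alpha>\<^sub>0 U)"
    then have "- x \<in> U"
      using U by (metis lie_on_sel(1) linear_subspace_def scale_minus_one)
    then show "\<exists>y\<in>carrier (lie_on \<phi> \<alpha>\<^sub>0 U). y \<oplus>\<^bsub>lie_on \<phi> \<alpha>\<^sub>0 U\<^esub> x = \<zero>\<^bsub>lie_on \<phi> \<alpha>\<^sub>0 U\<^esub>"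
      by force
  qed (use U in \<open>auto simp: linear_subspace_def algebra_simps\<close>)
  then show "module (ring_of_type_algebra :: 'f ring) (lie_on \<phi> \<alpha>\<^sub>0 U)"
    using U cring_from_type_algebra[where 'a = 'f]
    by (intro moduleI)
      (auto simp: linear_subspace_def scale_add_left scale_add_right scale_scale)
  show "lie_algebra_axioms (ring_of_type_algebra :: 'f ring) (lie_on \<phi> \<alpha>\<^sub>0 U)"
    by unfold_locales
      (simp_all add: closed bracket2_add_left bracket2_add_right bracket2_scale_left
        bracket2_scale_right bracket2_jacobi[OF additive] bracket2_self)
qed

section \<open>Polynomials in the derivations that preserve an ideal\<close>

lemma linear_subspaceD:
  assumes "linear_subspace I"
  shows "0 \<in> I" and "\<And>u v. u \<in> I \<Longrightarrow> v \<in> I \<Longrightarrow> u + v \<in> I"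
    and "\<And>c u. u \<in> I \<Longrightarrow> scale c u \<in> I"
    and "\<And>u v. u \<in> I \<Longrightarrow> v \<in> I \<Longrightarrow> u - v \<in> I"
proof -
  show 1: "0 \<in> I" "\<And>u v. u \<in> I \<Longrightarrow> v \<in> I \<Longrightarrow> u + v \<in> I" "\<And>c u. u \<in> I \<Longrightarrow> scale c u \<in> I"
    using assms by (auto simp: linear_subspace_def)
  fix u v assume "u \<in> I" "v \<in> I"
  then show "u - v \<in> I"
    using 1(2)[OF _ 1(3)[of v "-1"], of u] by (simp add: scale_minus_one)
qed

lemma linear_subspace_scaleD:
  fixes u :: "('g, 'f::field) galg"
  assumes "linear_subspace I" "scale c u \<in> I" "c \<noteq> 0"
  shows "u \<in> I"
  using linear_subspaceD(3)[OF assms(1,2), of "inverse c"] assms(3) by (simp add: scale_scale)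

text \<open>
  With \<open>y = x\<^bsup>\<gamma>\<^esup>\<close>, the operators \<open>X\<^sub>k = y\<^bsup>k\<^esup> (k g F + \<Lambda>)\<close> map \<open>I\<close> to itself. The products \<open>X\<^bsub>-1\<^esub> X\<^sub>1\<close> and
  \<open>X\<^bsub>-2\<^esub> X\<^sub>1 X\<^sub>1\<close> are polynomials in \<open>F\<close> and \<open>\<Lambda>\<close>, and modulo \<open>\<Lambda>\<close> they reduce to
  \<open>F\<^sup>2 - m F\<close> and to \<open>F (F\<^sup>2 - m F)\<close>, up to nonzero constants.
\<close>

lemma quadratic_operator_preserves:
  fixes I :: "('g::ab_group_add, 'f::field_char_0) galg set"
  assumes I: "linear_subspace I"
    and F_add: "\<And>u v. F (u + v) = F u + F v" and F_scale: "\<And>c u. F (scale c u) = scale c (F u)"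
    and L_add: "\<And>u v. \<Lambda> (u + v) = \<Lambda> u + \<Lambda> v" and L_scale: "\<And>c u. \<Lambda> (scale c u) = scale c (\<Lambda> u)"
    and comm: "\<And>u. \<Lambda> (F u) = F (\<Lambda> u)"
    and F_shift: "\<And>u. F (xmon \<gamma> 0 * u) = xmon \<gamma> 0 * F u"
    and L_shift: "\<And>u. \<Lambda> (xmon \<gamma> 0 * u) = xmon \<gamma> 0 * (\<Lambda> u + scale (g * m) u)"
    and g: "g \<noteq> 0"
    and L_in: "\<And>u. u \<in> I \<Longrightarrow> \<Lambda> u \<in> I"
    and X1: "\<And>u. u \<in> I \<Longrightarrow> xmon \<gamma> 0 * (scale g (F u) + \<Lambda> u) \<in> I"
    and X_minus1: "\<And>u. u \<in> I \<Longrightarrow> xmon (- \<gamma>) 0 * (scale (- g) (F u) + \<Lambda> u) \<in> I"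
    and X_minus2: "\<And>u. u \<in> I \<Longrightarrow> xmon (- \<gamma> - \<gamma>) 0 * (scale (- 2 * g) (F u) + \<Lambda> u) \<in> I"
    and u: "u \<in> I"
  shows "F (F u) - scale m (F u) \<in> I" and "F (F (F u) - scale m (F u)) \<in> I"
proof -
  define K :: "'f \<Rightarrow> ('g, 'f) galg" where "K = Poly_Mapping.single 0"
  define G M where "G = K g" and "M = K m"
  have K: "K (c * d) = K c * K d" "K (numeral n) = numeral n" "K (- c) = - K c" for c d n
    by (simp_all add: K_def mult_single single_uminus)
  have scale_K: "scale c w = K c * w" for c w
    by (simp add: scale_eq K_def)
  define y z :: "('g, 'f) galg" where "y = xmon \<gamma> 0" and "z = xmon (- \<gamma>) 0"
  have zy: "z * (y * w) = w" for w
    by (simp add: y_def z_def mult.assoc[symmetric] mult_single flip: zero_prod_def)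
  have zz: "xmon (- \<gamma> - \<gamma>) 0 = z * z"
    by (simp add: z_def mult_single)
  have sc: "scale g w = G * w" "scale (- g) w = - (G * w)" "scale m w = M * w"
      "scale (g * m) w = G * M * w" "scale (- 2 * g) w = - (2 * (G * w))"
      "scale (g * g) w = G * G * w" "scale (- 2 * g * g * g) w = - (2 * (G * G * G * w))"
    for w :: "('g, 'f) galg"
    by (simp_all add: scale_K G_def M_def K algebra_simps)
  have minus: "F (- v) = - F v" "\<Lambda> (- v) = - \<Lambda> v" for v
    using F_scale[of "-1" v] L_scale[of "-1" v] by (simp_all add: scale_minus_one)
  have diff: "F (v - w) = F v - F w" "\<Lambda> (v - w) = \<Lambda> v - \<Lambda> w" for v w
    using F_add[of v "- w"] L_add[of v "- w"] by (simp_all add: minus)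
  have lin: "F (G * v) = G * F v" "F (M * v) = M * F v" "\<Lambda> (G * v) = G * \<Lambda> v" "\<Lambda> (M * v) = M * \<Lambda> v" for v
    using F_scale[of g v] F_scale[of m v] L_scale[of g v] L_scale[of m v] by (simp_all add: sc)
  have shift: "F (y * v) = y * F v" "\<Lambda> (y * v) = y * (\<Lambda> v + G * M * v)" for v
    using F_shift L_shift by (simp_all add: y_def sc)
  define q where "q = F (F u) - M * F u"
  define Z where "Z v = G * F v + \<Lambda> v" for v
  \<comment> \<open>Moving \<open>Z\<close> past \<open>y\<close> adds \<open>G * M\<close>, the
    weight of \<open>y\<close> under \<open>\<Lambda>\<close>.\<close>
  define Z' where "Z' v = G * F v + \<Lambda> v + G * M * v" for v
  have yX: "y * Z v \<in> I" if "v \<in> I" for v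
    using X1[OF that] by (simp add: y_def Z_def sc)
  have Xy: "Z (y * v) = y * Z' v" for v
    unfolding Z_def Z'_def shift by (simp add: algebra_simps)
  have "z * (- (G * F (y * Z u)) + \<Lambda> (y * Z u)) \<in> I"
    using X_minus1[OF yX[OF u]] by (simp add: z_def sc)
  moreover have "z * (- (G * F (y * Z u)) + \<Lambda> (y * Z u))
      = - (G * F (Z u)) + \<Lambda> (Z u) + G * M * Z u"
  proof -
    have "- (G * F (y * Z u)) + \<Lambda> (y * Z u) = y * (- (G * F (Z u)) + \<Lambda> (Z u) + G * M * Z u)"
      unfolding shift by (simp add: algebra_simps)
    then show ?thesis
      by (simp only: zy)
  qed
  \<comment> \<open>This is X_{-1} X_1 u solved for \<open>q\<close>: the terms mixing
    \<open>F\<close> and \<open>\<Lambda>\<close> cancel by commutation, and what remains beside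
    \<open>q\<close> is built from \<open>u\<close> by \<open>\<Lambda>\<close> alone.\<close>
  moreover have "G * G * q = \<Lambda> (\<Lambda> u) + G * M * \<Lambda> u - (- (G * F (Z u)) + \<Lambda> (Z u) + G * M * Z u)"
    by (simp add: q_def Z_def F_add L_add comm lin algebra_simps)
  moreover have "\<Lambda> (\<Lambda> u) + G * M * \<Lambda> u \<in> I"
    using linear_subspaceD(2,3)[OF I] L_in u by (metis sc(4))
  ultimately have "scale (g * g) q \<in> I"
    by (simp add: sc linear_subspaceD[OF I])
  then have q: "q \<in> I"
    by (rule linear_subspace_scaleD[OF I]) (use g in simp)
  then show "F (F u) - scale m (F u) \<in> I"
    by (simp add: q_def sc)
  define w where "w = y * Z (y * Z u)"
  have "w \<in> I"
    using yX yX u by (simp add: w_def)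
  then have "z * z * (- (2 * (G * F w)) + \<Lambda> w) \<in> I"
    using X_minus2[of w] by (simp only: zz sc)
  moreover have "z * z * (- (2 * (G * F w)) + \<Lambda> w)
      = - (2 * (G * F (Z' (Z u)))) + \<Lambda> (Z' (Z u)) + 2 * (G * M * Z' (Z u))"
  proof -
    have "- (2 * (G * F w)) + \<Lambda> w
        = y * (y * (- (2 * (G * F (Z' (Z u)))) + \<Lambda> (Z' (Z u)) + 2 * (G * M * Z' (Z u))))"
      unfolding w_def Xy shift by (simp add: algebra_simps)
    then show ?thesis
      by (simp only: mult.assoc zy)
  qed
  \<comment> \<open>Likewise X_{-2} X_1 X_1 u solved for \<open>F q\<close>. Each correction term is
    a multiple of \<open>q\<close> or of an image under \<open>\<Lambda>\<close> of \<open>q\<close>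
    or \<open>u\<close>, hence in \<open>I\<close>.\<close>
  moreover have "- (2 * (G * G * G * F q)) =
      - (2 * (G * F (Z' (Z u)))) + \<Lambda> (Z' (Z u)) + 2 * (G * M * Z' (Z u))
      - (- (2 * (G * M * (G * G * q))) - 3 * (G * G * \<Lambda> q) + 2 * (G * M * (G * M * \<Lambda> u))
         + 3 * (G * M * \<Lambda> (\<Lambda> u)) + \<Lambda> (\<Lambda> (\<Lambda> u)))"
  proof -
    \<comment> \<open>\<open>F\<close> is kept outside \<open>\<Lambda>\<close> and constants
      outside both, so that equal operator words agree syntactically before ring
      normalisation.\<close>
    have h: "Z' (Z u) = G * (G * F (F u)) + (G * F (\<Lambda> u) + G * F (\<Lambda> u)) + \<Lambda> (\<Lambda> u)
        + G * (M * (G * F u)) + G * (M * \<Lambda> u)"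
      unfolding Z_def Z'_def F_add L_add lin comm by (simp add: algebra_simps)
    have Fh: "F (Z' (Z u)) = G * (G * F (F (F u))) + (G * F (F (\<Lambda> u)) + G * F (F (\<Lambda> u)))
        + F (\<Lambda> (\<Lambda> u)) + G * (M * (G * F (F u))) + G * (M * F (\<Lambda> u))"
      unfolding h by (simp only: F_add lin)
    have Lh: "\<Lambda> (Z' (Z u)) = G * (G * F (F (\<Lambda> u))) + (G * F (\<Lambda> (\<Lambda> u)) + G * F (\<Lambda> (\<Lambda> u)))
        + \<Lambda> (\<Lambda> (\<Lambda> u)) + G * (M * (G * F (\<Lambda> u))) + G * (M * \<Lambda> (\<Lambda> u))"
      unfolding h by (simp only: L_add lin comm)
    have Fq: "F q = F (F (F u)) - M * F (F u)" "\<Lambda> q = F (F (\<Lambda> u)) - M * F (\<Lambda> u)"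
      unfolding q_def by (simp_all only: diff lin comm)
    show ?thesis
      unfolding Fh Lh Fq unfolding h q_def by (simp add: algebra_simps)
  qed
  moreover have "- (2 * (G * M * (G * G * q))) - 3 * (G * G * \<Lambda> q) + 2 * (G * M * (G * M * \<Lambda> u))
         + 3 * (G * M * \<Lambda> (\<Lambda> u)) + \<Lambda> (\<Lambda> (\<Lambda> u)) \<in> I"
  proof -
    have "scale (- 2 * (g * m) * (g * g)) q - scale (3 * (g * g)) (\<Lambda> q)
        + scale (2 * (g * m) * (g * m)) (\<Lambda> u) + scale (3 * (g * m)) (\<Lambda> (\<Lambda> u)) + \<Lambda> (\<Lambda> (\<Lambda> u)) \<in> I"
      using q u by (intro linear_subspaceD(2-4)[OF I] L_in)
    moreover have "scale (- 2 * (g * m) * (g * g)) q = - (2 * (G * M * (G * G * q)))"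
      "scale (3 * (g * g)) (\<Lambda> q) = 3 * (G * G * \<Lambda> q)"
      "scale (2 * (g * m) * (g * m)) (\<Lambda> u) = 2 * (G * M * (G * M * \<Lambda> u))"
      "scale (3 * (g * m)) (\<Lambda> (\<Lambda> u)) = 3 * (G * M * \<Lambda> (\<Lambda> u))"
      by (simp_all add: scale_K G_def M_def K)
    ultimately show ?thesis
      by simp
  qed
  ultimately have "scale (- 2 * g * g * g) (F q) \<in> I"
    by (simp only: sc linear_subspaceD[OF I])
  then have "F q \<in> I"
    by (rule linear_subspace_scaleD[OF I]) (use g in simp)
  then show "F (F (F u) - scale m (F u)) \<in> I"
    by (simp add: q_def sc)
qed

section \<open>Eigenvectors of the derivations\<close>

text \<open>Folded over a list, this gives a polynomial in \<open>partial \<phi> p\<close> with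
  listed roots.\<close>

definition partial_minus ::
    "(4 \<Rightarrow> 'g \<Rightarrow> 'f::field) \<Rightarrow> 4 \<Rightarrow> 'f \<Rightarrow> ('g, 'f) galg \<Rightarrow> ('g, 'f) galg"
  where "partial_minus \<phi> p c u = partial \<phi> p u - scale c u"

lemma partial_minus_linear:
  "partial_minus \<phi> p c (u + v) = partial_minus \<phi> p c u + partial_minus \<phi> p c v"
  "partial_minus \<phi> p c (scale d u) = scale d (partial_minus \<phi> p c u)"
  "partial_minus \<phi> p c 0 = 0"
  by (simp_all add: partial_minus_def partial_add partial_scale scale_add_right scale_diff_right
      scale_scale mult.commute)

lemma partial_minus_commute:
  "partial_minus \<phi> p c (partial_minus \<phi> p d u) = partial_minus \<phi> p d (partial_minus \<phi> p c u)"
  by (simp add: partial_minus_def partial_diff partial_scale scale_diff_right scale_scale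
      mult.commute algebra_simps)

lemma foldr_partial_minus_linear:
  "foldr (partial_minus \<phi> p) cs (u + v) = foldr (partial_minus \<phi> p) cs u + foldr (partial_minus \<phi> p) cs v"
  "foldr (partial_minus \<phi> p) cs (scale d u) = scale d (foldr (partial_minus \<phi> p) cs u)"
  "foldr (partial_minus \<phi> p) cs 0 = 0"
  by (induction cs) (simp_all add: partial_minus_linear)

lemma foldr_partial_minus_commute:
  "foldr (partial_minus \<phi> p) cs (foldr (partial_minus \<phi> p) ds u)
     = foldr (partial_minus \<phi> p) ds (foldr (partial_minus \<phi> p) cs u)"
proof -
  have "partial_minus \<phi> p c (foldr (partial_minus \<phi> p) ds v)
      = foldr (partial_minus \<phi> p) ds (partial_minus \<phi> p c v)" for c v
    by (induction ds) (simp_all add: partial_minus_commute[of \<phi> p c])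
  then show ?thesis
    by (induction cs) simp_all
qed

text \<open>Each factor cancels the weight term and lowers the exponent at \<open>p\<close>, so one
  factor more than the exponent kills the monomial.\<close>

lemma foldr_partial_minus_xmon:
  "i $ p < n \<Longrightarrow> foldr (partial_minus \<phi> p) (replicate n (\<phi> p \<alpha>)) (xmon \<alpha> i) = 0"
proof (induction n arbitrary: i)
  case (Suc n)
  have "foldr (partial_minus \<phi> p) (replicate (Suc n) (\<phi> p \<alpha>)) (xmon \<alpha> i)
      = foldr (partial_minus \<phi> p) (replicate n (\<phi> p \<alpha>)) (partial_minus \<phi> p (\<phi> p \<alpha>) (xmon \<alpha> i))"
    by (simp add: funpow_swap1)
  also have "\<dots> = scale (of_nat (i $ p))
      (foldr (partial_minus \<phi> p) (replicate n (\<phi> p \<alpha>)) (xmon \<alpha> (i - axis p 1)))"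
  proof -
    have "partial_minus \<phi> p (\<phi> p \<alpha>) (xmon \<alpha> i) = scale (of_nat (i $ p)) (xmon \<alpha> (i - axis p 1))"
      by (simp add: partial_minus_def partial_xmon)
    then show ?thesis
      by (simp only: foldr_partial_minus_linear)
  qed
  also have "\<dots> = 0"
    using Suc.IH[of "i - axis p 1"] Suc.prems by (cases "i $ p = 0") (auto simp: axis_def)
  finally show ?case .
qed simp

text \<open>Local finiteness. Monomials have annihilators, and as the factors commute, concatenated
  lists annihilate sums.\<close>

lemma partial_minus_annihilator: "\<exists>cs. foldr (partial_minus \<phi> p) cs u = 0"
proof (induction u rule: galg_span_induct[OF subset_UNIV])
  case 1
  then show ?case
    by (intro exI[of _ "[]"]) simp
next
  case (2 v w)
  then obtain cs ds where "foldr (partial_minus \<phi> p) cs v = 0" "foldr (partial_minus \<phi> p) ds w = 0"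
    by blast
  then have "foldr (partial_minus \<phi> p) (cs @ ds) (v + w) = 0"
    by (simp add: foldr_partial_minus_linear foldr_partial_minus_commute[of _ _ cs])
  then show ?case ..
next
  case (3 c \<alpha> i)
  have "foldr (partial_minus \<phi> p) (replicate (Suc (i $ p)) (\<phi> p \<alpha>)) (scale c (xmon \<alpha> i)) = 0"
    by (simp only: foldr_partial_minus_linear foldr_partial_minus_xmon[OF lessI] scale_zero_right)
  then show ?case ..
qed

text \<open>Apply the factors of an annihilating product one at a time: the last nonzero vector is
  an eigenvector and still lies in \<open>M\<close>.\<close>

lemma eigenvector_exists:
  assumes stable: "\<And>c w. w \<in> M \<Longrightarrow> partial \<phi> p w - scale c w \<in> M"
    and u: "u \<in> M" "u \<noteq> 0"
  obtains c w where "w \<in> M" "w \<noteq> 0" "partial \<phi> p w = scale c w"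
proof -
  obtain cs where "foldr (partial_minus \<phi> p) cs u = 0"
    using partial_minus_annihilator by blast
  then have "\<exists>c w. w \<in> M \<and> w \<noteq> 0 \<and> partial \<phi> p w = scale c w"
  proof (induction cs)
    case (Cons c cs)
    let ?w = "foldr (partial_minus \<phi> p) cs u"
    have "?w \<in> M"
      by (induction cs) (use u stable in \<open>auto simp: partial_minus_def\<close>)
    moreover have "partial \<phi> p ?w = scale c ?w"
      using Cons.prems by (simp add: partial_minus_def[of _ _ _ ?w])
    ultimately show ?case
      using Cons.IH by (cases "?w = 0") blast+
  qed (use u in simp)
  then show ?thesis
    using that by blast
qed

text \<open>Among the exponents occurring with \<beta> take one that is largest at \<open>p\<close>:
  no higher term feeds its coefficient, so the weight is \<open>c\<close>. The recursion then
  excludes positive exponents, by characteristic 0.\<close>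

lemma eigenvalue_weight:
  fixes u :: "('g, 'f::field_char_0) galg" and j :: "nat ^ 4"
  assumes eigen: "partial \<phi> p u = scale c u" and key: "(\<beta>, j) \<in> Poly_Mapping.keys u"
  shows "\<phi> p \<beta> = c" and "j $ p = 0"
proof -
  have rec: "(c - \<phi> p \<beta>) * Poly_Mapping.lookup u (\<beta>, i)
      = of_nat (Suc (i $ p)) * Poly_Mapping.lookup u (\<beta>, i + axis p 1)" for i
    using lookup_partial[of \<phi> p u \<beta> i] by (simp add: eigen lookup_scale algebra_simps)
  let ?S = "{k \<in> Poly_Mapping.keys u. fst k = \<beta>}"
  have fin: "finite ((\<lambda>k. snd k $ p) ` ?S)" and ne: "(\<lambda>k. snd k $ p) ` ?S \<noteq> {}"
    using key by auto
  from Max_in[OF this] obtain i where i: "(\<beta>, i) \<in> Poly_Mapping.keys u"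
      "i $ p = Max ((\<lambda>k. snd k $ p) ` ?S)"
    by auto
  have "(\<beta>, i + axis p 1) \<notin> Poly_Mapping.keys u"
  proof
    assume "(\<beta>, i + axis p 1) \<in> Poly_Mapping.keys u"
    then have "(i + axis p 1) $ p \<le> Max ((\<lambda>k. snd k $ p) ` ?S)"
      by (intro Max_ge[OF fin] image_eqI[where x = "(\<beta>, i + axis p 1)"]) auto
    then show False
      using i(2) by (simp add: axis_def)
  qed
  then show weight: "\<phi> p \<beta> = c"
    using rec[of i] i(1) by (simp add: in_keys_iff)
  show "j $ p = 0"
  proof (rule ccontr)
    assume "j $ p \<noteq> 0"
    then have "j - axis p 1 + axis p 1 = j"
      by (auto simp: vec_eq_iff axis_def)
    \<comment> \<open>With the weight equal to \<open>c\<close> the left side of \<open>rec\<close>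
      vanishes; taken one step below \<open>j\<close> it kills the coefficient at
      \<open>j\<close>.\<close>
    then have "of_nat (Suc ((j - axis p 1) $ p)) * Poly_Mapping.lookup u (\<beta>, j) = 0"
      using rec[of "j - axis p 1"] weight by simp
    then show False
      using key by (simp add: in_keys_iff del: of_nat_Suc)
  qed
qed

section \<open>Ideals and their monomials\<close>

locale w_type_data =
  fixes J :: "4 \<Rightarrow> nat set"
    and \<phi> :: "4 \<Rightarrow> 'g::ab_group_add \<Rightarrow> 'f::field_char_0"
    and \<alpha>\<^sub>0 :: 'g
  assumes J: "\<And>p. J p = {0} \<or> J p = UNIV"
    and additive: "\<And>p. additive (\<phi> p)"
    and ker_all: "(\<Inter>p. ker (\<phi> p)) = {0}"
    and ker_but_one: "\<And>p. (\<Inter>q\<in>UNIV - {p}. ker (\<phi> q)) - ker (\<phi> p) \<noteq> {}"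
    and \<alpha>\<^sub>0: "\<alpha>\<^sub>0 \<notin> (ker (\<phi> 1) \<inter> ker (\<phi> 2)) \<union> (ker (\<phi> 3) \<inter> ker (\<phi> 4))"
begin

section \<open>Weights, coordinate directions and the adjoint action of monomials\<close>

abbreviation "D \<equiv> partial \<phi>"
abbreviation "E \<equiv> shifted_partial \<phi> \<alpha>\<^sub>0"
abbreviation "br \<equiv> bracket2 \<phi> \<alpha>\<^sub>0"
abbreviation "star \<equiv> star_cond \<phi> \<alpha>\<^sub>0"

lemma phi_simps [simp]:
  "\<phi> p (\<alpha> + \<beta>) = \<phi> p \<alpha> + \<phi> p \<beta>" "\<phi> p 0 = 0" "\<phi> p (- \<alpha>) = - \<phi> p \<alpha>"
  "\<phi> p (\<alpha> - \<beta>) = \<phi> p \<alpha> - \<phi> p \<beta>"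
  by (simp_all add: additive.add additive.zero additive.minus additive.diff additive)

lemma weight_eqI: "(\<And>p. \<phi> p \<alpha> = \<phi> p \<beta>) \<Longrightarrow> \<alpha> = \<beta>"
proof -
  assume "\<And>p. \<phi> p \<alpha> = \<phi> p \<beta>"
  then have "\<alpha> - \<beta> \<in> (\<Inter>p. ker (\<phi> p))"
    by (simp add: ker_def)
  then show ?thesis
    by (simp add: ker_all)
qed

lemma weight_eqI4:
  "\<phi> 1 \<alpha> = \<phi> 1 \<beta> \<Longrightarrow> \<phi> 2 \<alpha> = \<phi> 2 \<beta> \<Longrightarrow> \<phi> 3 \<alpha> = \<phi> 3 \<beta> \<Longrightarrow> \<phi> 4 \<alpha> = \<phi> 4 \<beta> \<Longrightarrow> \<alpha> = \<beta>"
  using weight_eqI exhaust_4 by metis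

lemma alpha0_12: "\<phi> 1 \<alpha>\<^sub>0 \<noteq> 0 \<or> \<phi> 2 \<alpha>\<^sub>0 \<noteq> 0"
  and alpha0_34: "\<phi> 3 \<alpha>\<^sub>0 \<noteq> 0 \<or> \<phi> 4 \<alpha>\<^sub>0 \<noteq> 0"
  using \<alpha>\<^sub>0 by (auto simp: ker_def)

text \<open>A coordinate direction: \<open>ker_but_one\<close> supplies an element seen by
  \<open>\<phi> p\<close> alone, so weights can be moved one coordinate at a time.\<close>

definition ax :: "4 \<Rightarrow> 'g"
  where "ax p = (SOME \<gamma>. \<phi> p \<gamma> \<noteq> 0 \<and> (\<forall>q. q \<noteq> p \<longrightarrow> \<phi> q \<gamma> = 0))"

lemma ax: "\<phi> p (ax p) \<noteq> 0" "q \<noteq> p \<Longrightarrow> \<phi> q (ax p) = 0"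
proof -
  have "\<exists>\<gamma>. \<phi> p \<gamma> \<noteq> 0 \<and> (\<forall>q. q \<noteq> p \<longrightarrow> \<phi> q \<gamma> = 0)"
    using ker_but_one[of p] by (auto simp: ker_def)
  then have "\<phi> p (ax p) \<noteq> 0 \<and> (\<forall>q. q \<noteq> p \<longrightarrow> \<phi> q (ax p) = 0)"
    unfolding ax_def by (rule someI_ex)
  then show "\<phi> p (ax p) \<noteq> 0" "q \<noteq> p \<Longrightarrow> \<phi> q (ax p) = 0"
    by auto
qed

definition ax_mult :: "nat \<Rightarrow> 4 \<Rightarrow> 'g"
  where "ax_mult n p = (\<Sum>k<n. ax p)"

lemma phi_ax_mult: "\<phi> q (ax_mult n p) = (if q = p then of_nat n * \<phi> p (ax p) else 0)"
  by (simp add: ax_mult_def additive.sum[OF additive] ax)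

text \<open>\<open>star\<close> would give \<alpha> the first two weights of
  \<open>\<alpha>\<^sub>0\<close>, which are not both 0. So the monomials acting through
  \<open>E 3\<close> and \<open>E 4\<close> only are never the excluded one.\<close>

lemma not_star12: "\<phi> 1 \<alpha> = 0 \<Longrightarrow> \<phi> 2 \<alpha> = 0 \<Longrightarrow> \<not> star \<alpha>"
  using alpha0_12 by (auto simp: star_cond_def)

lemma not_star34: "\<phi> 3 \<alpha> = - \<phi> 3 \<alpha>\<^sub>0 \<Longrightarrow> \<phi> 4 \<alpha> = - \<phi> 4 \<alpha>\<^sub>0 \<Longrightarrow> \<not> star \<alpha>"
  using alpha0_34 by (auto simp: star_cond_def)

lemma E_simps:
  "E p (u + v) = E p u + E p v" "E p (u - v) = E p u - E p v" "E p (scale c u) = scale c (E p u)"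
  by (simp_all add: shifted_partial_def partial_add partial_diff partial_scale scale_add_right
      scale_diff_right scale_scale mult.commute)

lemma E_12 [simp]: "E 1 = D 1" "E 2 = D 2"
  by (simp_all add: shifted_partial_def fun_eq_iff)

lemma E_commute: "E p (E q u) = E q (E p u)"
  by (simp add: shifted_partial_def partial_add partial_scale scale_add_right
      scale_scale mult.commute partial_commute[of _ p] algebra_simps)

lemma E_D_commute: "E p (D q u) = D q (E p u)"
  by (simp add: shifted_partial_def partial_add partial_scale partial_commute[of _ p])

lemma D_xmon_mult: "D p (xmon \<alpha> 0 * u) = xmon \<alpha> 0 * (D p u + scale (\<phi> p \<alpha>) u)"
  by (simp add: partial_mult[OF additive] partial_xmon_zero) (simp add: scale_eq algebra_simps)

lemma E_xmon_mult: "E p (xmon \<alpha> 0 * u) = xmon \<alpha> 0 * (E p u + scale (\<phi> p \<alpha>) u)"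
  by (simp add: shifted_partial_def D_xmon_mult) (simp add: scale_eq algebra_simps)

lemma br_xmon:
  "br (xmon \<alpha> 0) u =
     xmon \<alpha> 0 * (xmon \<alpha>\<^sub>0 0 * (scale (\<phi> 1 \<alpha>) (D 2 u) - scale (\<phi> 2 \<alpha>) (D 1 u))
       + (scale (\<phi> 3 \<alpha> + \<phi> 3 \<alpha>\<^sub>0) (E 4 u) - scale (\<phi> 4 \<alpha> + \<phi> 4 \<alpha>\<^sub>0) (E 3 u)))"
proof -
  have E: "E p (xmon \<alpha> 0) = scale (\<phi> p \<alpha> + weight_shift \<phi> \<alpha>\<^sub>0 p) (xmon \<alpha> 0)" for p
    by (simp add: shifted_partial_def partial_xmon_zero scale_add_left)
  show ?thesis
    by (simp add: bracket2_eq E partial_xmon_zero scale_mult_left scale_mult_right algebra_simps)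
qed

lemma br_xmon_12:
  "\<phi> 1 \<alpha> = 0 \<Longrightarrow> \<phi> 2 \<alpha> = 0 \<Longrightarrow> br (xmon \<alpha> 0) u =
     xmon \<alpha> 0 * (scale (\<phi> 3 \<alpha> + \<phi> 3 \<alpha>\<^sub>0) (E 4 u) - scale (\<phi> 4 \<alpha> + \<phi> 4 \<alpha>\<^sub>0) (E 3 u))"
  by (simp add: br_xmon)

text \<open>Subtracting \<open>\<alpha>\<^sub>0\<close> absorbs the factor
  \<open>xmon \<alpha>\<^sub>0 0\<close> of the bracket and makes the coefficients of
  \<open>E 3\<close> and \<open>E 4\<close> vanish.\<close>

lemma br_xmon_34:
  assumes "\<phi> 3 \<delta> = 0" "\<phi> 4 \<delta> = 0"
  shows "br (xmon (\<delta> - \<alpha>\<^sub>0) 0) u =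
    xmon \<delta> 0 * (scale (\<phi> 1 \<delta> - \<phi> 1 \<alpha>\<^sub>0) (D 2 u) - scale (\<phi> 2 \<delta> - \<phi> 2 \<alpha>\<^sub>0) (D 1 u))"
  using assms by (simp add: br_xmon mult.assoc[symmetric] mult_single)

text \<open>
  The monomial \<open>x\<^bsup>\<rho>,0\<^esup>\<close> is left out, so that \<open>ad_stable\<close> also applies to the ideals of the
  derived algebra in case (b).
\<close>

definition ad_stable :: "('g, 'f) galg set \<Rightarrow> bool"
  where "ad_stable I \<longleftrightarrow> linear_subspace I
    \<and> (\<forall>\<alpha> i u. \<not> star \<alpha> \<and> i \<in> vecJ J \<and> u \<in> I \<longrightarrow> br (xmon \<alpha> i) u \<in> I)"

text \<open>The constant for which moving \<open>\<Lambda>\<close> past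
  \<open>xmon (ax q) 0\<close>, with \<open>q\<close> the partner index of \<open>p\<close>, adds
  \<open>g * quad_root p\<close>.\<close>

definition quad_root :: "4 \<Rightarrow> 'f"
  where "quad_root p = (if p \<in> {1, 2} then \<phi> p \<alpha>\<^sub>0 else - \<phi> p \<alpha>\<^sub>0)"

lemma quad_root_simps:
  "quad_root 1 = \<phi> 1 \<alpha>\<^sub>0" "quad_root 2 = \<phi> 2 \<alpha>\<^sub>0" "quad_root 3 = - \<phi> 3 \<alpha>\<^sub>0" "quad_root 4 = - \<phi> 4 \<alpha>\<^sub>0"
  by (simp_all add: quad_root_def)

definition quad :: "4 \<Rightarrow> ('g, 'f) galg \<Rightarrow> ('g, 'f) galg"
  where "quad p u = E p (E p u) - scale (quad_root p) (E p u)"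

lemma zero_in_vecJ: "0 \<in> vecJ J"
  using J by (auto simp: vecJ_def)

lemma ad_stableD:
  assumes "ad_stable I"
  shows "linear_subspace I" and "\<And>\<alpha> u. \<not> star \<alpha> \<Longrightarrow> u \<in> I \<Longrightarrow> br (xmon \<alpha> 0) u \<in> I"
    and "\<And>\<alpha> i u. \<not> star \<alpha> \<Longrightarrow> i \<in> vecJ J \<Longrightarrow> u \<in> I \<Longrightarrow> br (xmon \<alpha> i) u \<in> I"
  using assms zero_in_vecJ by (auto simp: ad_stable_def)

lemma xmon_zero_mult: "xmon 0 0 * u = (u :: ('g, 'f) galg)"
  by (simp flip: zero_prod_def)

text \<open>Pair 1 with 2 and 3 with 4, and let \<open>q\<close> be the partner of \<open>p\<close>.
  Since \<open>\<phi> p (ax q) = 0\<close>, \<open>E p\<close> commutes with multiplication by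
  monomials along \<open>ax q\<close>, and \<open>quadratic_operator_preserves\<close> applies in
  that direction.\<close>

lemma quad_in:
  assumes I: "ad_stable I" and u: "u \<in> I"
  shows "quad p u \<in> I" and "E p (quad p u) \<in> I"
proof -
  note sub = ad_stableD(1)[OF I]
  have K: "br (xmon \<gamma> 0) v \<in> I" if "\<phi> 1 \<gamma> = 0" "\<phi> 2 \<gamma> = 0" "v \<in> I" for \<gamma> v
    using ad_stableD(2)[OF I not_star12[of \<gamma>]] that by blast
  have K': "br (xmon (\<delta> - \<alpha>\<^sub>0) 0) v \<in> I" if "\<phi> 3 \<delta> = 0" "\<phi> 4 \<delta> = 0" "v \<in> I" for \<delta> v
    using ad_stableD(2)[OF I not_star34[of "\<delta> - \<alpha>\<^sub>0"]] that by simp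
  \<comment> \<open>\<open>L\<close> is the adjoint action of 1, and \<open>L'\<close> that of
    \<open>xmon (- \<alpha>\<^sub>0) 0\<close>; they serve as \<open>\<Lambda>\<close> for the two
    pairs.\<close>
  define L where "L v = scale (\<phi> 3 \<alpha>\<^sub>0) (E 4 v) - scale (\<phi> 4 \<alpha>\<^sub>0) (E 3 v)" for v
  define L' where "L' v = scale (- \<phi> 1 \<alpha>\<^sub>0) (E 2 v) - scale (- \<phi> 2 \<alpha>\<^sub>0) (E 1 v)" for v
  have linear: "L (v + w) = L v + L w" "L (scale c v) = scale c (L v)" "L (E p v) = E p (L v)"
    "L' (v + w) = L' v + L' w" "L' (scale c v) = scale c (L' v)" "L' (E p v) = E p (L' v)" for c v w p
    unfolding L_def L'_def
    by (simp_all only: E_simps E_commute[of _ p] scale_add_right scale_diff_right scale_scale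
        mult.commute add_diff_add)
  have L_shift: "L (xmon \<gamma> 0 * v) = xmon \<gamma> 0 * (L v + scale (\<phi> 3 \<alpha>\<^sub>0 * \<phi> 4 \<gamma> - \<phi> 4 \<alpha>\<^sub>0 * \<phi> 3 \<gamma>) v)"
    and L'_shift: "L' (xmon \<gamma> 0 * v) = xmon \<gamma> 0 * (L' v + scale (\<phi> 2 \<alpha>\<^sub>0 * \<phi> 1 \<gamma> - \<phi> 1 \<alpha>\<^sub>0 * \<phi> 2 \<gamma>) v)"
    for \<gamma> v
    unfolding L_def L'_def E_xmon_mult
    by (simp_all add: scale_eq mult_single[of 0 _ 0, simplified, symmetric] single_diff single_uminus
        algebra_simps)
  have L_in: "L v \<in> I" if "v \<in> I" for v
    using K[of 0 v] that by (simp add: br_xmon_12 L_def xmon_zero_mult)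
  have L'_in: "L' v \<in> I" if "v \<in> I" for v
    using K'[of 0 v] br_xmon_34[of 0 v] that by (simp add: L'_def xmon_zero_mult)
  have X: "xmon \<gamma> 0 * (scale (\<phi> 3 \<gamma>) (E 4 v) - scale (\<phi> 4 \<gamma>) (E 3 v) + L v) \<in> I"
    if "\<phi> 1 \<gamma> = 0" "\<phi> 2 \<gamma> = 0" "v \<in> I" for \<gamma> v
  proof -
    have "br (xmon \<gamma> 0) v = xmon \<gamma> 0 * (scale (\<phi> 3 \<gamma>) (E 4 v) - scale (\<phi> 4 \<gamma>) (E 3 v) + L v)"
      unfolding br_xmon_12[OF that(1,2)] L_def scale_add_left by (simp only: add_diff_add)
    with K[OF that] show ?thesis by simp
  qed
  have X': "xmon \<delta> 0 * (scale (\<phi> 1 \<delta>) (E 2 v) - scale (\<phi> 2 \<delta>) (E 1 v) + L' v) \<in> I"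
    if "\<phi> 3 \<delta> = 0" "\<phi> 4 \<delta> = 0" "v \<in> I" for \<delta> v
  proof -
    have "br (xmon (\<delta> - \<alpha>\<^sub>0) 0) v
        = xmon \<delta> 0 * (scale (\<phi> 1 \<delta>) (E 2 v) - scale (\<phi> 2 \<delta>) (E 1 v) + L' v)"
      unfolding br_xmon_34[OF that(1,2)] L'_def diff_conv_add_uminus[of "\<phi> _ _"] scale_add_left E_12
      by (simp only: add_diff_add)
    with K'[OF that] show ?thesis by simp
  qed
  have "quad p u \<in> I \<and> E p (quad p u) \<in> I" if "g \<noteq> 0"
    and "\<And>v. \<Lambda> (E p v) = E p (\<Lambda> v)" "\<And>v w. \<Lambda> (v + w) = \<Lambda> v + \<Lambda> w"
      "\<And>c v. \<Lambda> (scale c v) = scale c (\<Lambda> v)" "\<And>v. v \<in> I \<Longrightarrow> \<Lambda> v \<in> I"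
    and "\<phi> p (ax q) = 0"
    and "\<And>v. \<Lambda> (xmon (ax q) 0 * v) = xmon (ax q) 0 * (\<Lambda> v + scale (g * quad_root p) v)"
    and X: "\<And>v. v \<in> I \<Longrightarrow> xmon (ax q) 0 * (scale g (E p v) + \<Lambda> v) \<in> I"
      "\<And>v. v \<in> I \<Longrightarrow> xmon (- ax q) 0 * (scale (- g) (E p v) + \<Lambda> v) \<in> I"
      "\<And>v. v \<in> I \<Longrightarrow> xmon (- ax q - ax q) 0 * (scale (- g - g) (E p v) + \<Lambda> v) \<in> I"
    for q g \<Lambda>
  proof -
    have "- 2 * g = - g - g"
      by simp
    note X = X this
    show ?thesis
      unfolding quad_def
      by (intro conjI; rule quadratic_operator_preserves[OF sub, where F = "E p" and \<Lambda> = \<Lambda>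
            and \<gamma> = "ax q" and g = g])
        (use that(1-7) u in \<open>simp_all only: E_simps E_xmon_mult X scale_zero_left add_0_right not_False_eq_True\<close>)
  qed
  note step = this
  consider "p = 4" | "p = 3" | "p = 2" | "p = 1"
    using exhaust_4 by metis
  then have "quad p u \<in> I \<and> E p (quad p u) \<in> I"
  proof cases
    case 1
    show ?thesis
      by (rule step[where q = 3 and g = "\<phi> 3 (ax 3)" and \<Lambda> = L])
        (use X[of "ax 3"] X[of "- ax 3"] X[of "- ax 3 - ax 3"] L_in in
          \<open>simp_all add: 1 linear L_shift ax quad_root_simps mult.commute[of "\<phi> _ (ax _)"] del: E_12\<close>)
  next
    case 2
    \<comment> \<open>\<open>E 3\<close> enters the adjoint action with a minus sign, hence the
      negative \<open>g\<close>; the same holds for \<open>E 1\<close> below.\<close>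
    show ?thesis
      by (rule step[where q = 4 and g = "- \<phi> 4 (ax 4)" and \<Lambda> = L])
        (use X[of "ax 4"] X[of "- ax 4"] X[of "- ax 4 - ax 4"] L_in in
          \<open>simp_all add: 2 linear L_shift ax quad_root_simps mult.commute[of "\<phi> _ (ax _)"] scale_uminus_left del: E_12\<close>)
  next
    case 3
    show ?thesis
      by (rule step[where q = 1 and g = "\<phi> 1 (ax 1)" and \<Lambda> = L'])
        (use X'[of "ax 1"] X'[of "- ax 1"] X'[of "- ax 1 - ax 1"] L'_in in
          \<open>simp_all add: 3 linear L'_shift ax quad_root_simps mult.commute[of "\<phi> _ (ax _)"] del: E_12\<close>)
  next
    case 4
    show ?thesis
      by (rule step[where q = 2 and g = "- \<phi> 2 (ax 2)" and \<Lambda> = L'])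
        (use X'[of "ax 2"] X'[of "- ax 2"] X'[of "- ax 2 - ax 2"] L'_in in
          \<open>simp_all add: 4 linear L'_shift ax quad_root_simps mult.commute[of "\<phi> _ (ax _)"] scale_uminus_left del: E_12\<close>)
  qed
  then show "quad p u \<in> I" "E p (quad p u) \<in> I"
    by auto
qed

lemma E_power_linear:
  "(E p ^^ n) (u + v) = (E p ^^ n) u + (E p ^^ n) v" "(E p ^^ n) (u - v) = (E p ^^ n) u - (E p ^^ n) v"
  "(E p ^^ n) (scale c u) = scale c ((E p ^^ n) u)"
  by (induction n) (simp_all add: E_simps)

text \<open>From E^2 q = q q + c E q, two powers of \<open>E p\<close> are traded for a second
  \<open>quad p\<close> and one power less. The induction starts at the powers 0 and 1 from
  \<open>quad_in\<close>.\<close>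

lemma E_power_quad_in:
  assumes I: "ad_stable I"
  shows "u \<in> I \<Longrightarrow> (E p ^^ n) (quad p u) \<in> I"
proof (induction n arbitrary: u rule: induct_nat_012)
  case (ge2 n)
  have "E p (E p (quad p u)) = quad p (quad p u) + scale (quad_root p) (E p (quad p u))"
    by (simp add: quad_def[of p "quad p u"])
  then have "(E p ^^ Suc (Suc n)) (quad p u)
      = (E p ^^ n) (quad p (quad p u)) + scale (quad_root p) ((E p ^^ Suc n) (quad p u))"
    by (simp only: funpow_Suc_right o_def E_power_linear)
  moreover have "quad p u \<in> I"
    using quad_in[OF I] ge2.prems by blast
  ultimately show ?case
    using ge2 linear_subspaceD[OF ad_stableD(1)[OF I]] by simp
qed (use quad_in[OF I] in simp_all)

section \<open>Joint eigenvectors in an ideal\<close>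

definition weights :: "('g, 'f) galg \<Rightarrow> 'g set"
  where "weights u = fst ` Poly_Mapping.keys u"

lemma weights_partial: "weights (D p u) \<subseteq> weights u"
proof
  fix \<beta> assume "\<beta> \<in> weights (D p u)"
  then obtain j where "Poly_Mapping.lookup (D p u) (\<beta>, j) \<noteq> 0"
    by (auto simp: weights_def in_keys_iff)
  then have "(\<beta>, j) \<in> Poly_Mapping.keys u \<or> (\<beta>, j + axis p 1) \<in> Poly_Mapping.keys u"
    by (auto simp: lookup_partial in_keys_iff)
  then show "\<beta> \<in> weights u"
    by (force simp: weights_def)
qed

lemma weights_scale: "weights (scale c u) \<subseteq> weights u"
  using keys_scale_subset by (auto simp: weights_def)

lemma weights_add: "weights (u + v) \<subseteq> weights u \<union> weights v"
  using keys_add[of u v] by (auto simp: weights_def)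

lemma weights_diff: "weights (u - v) \<subseteq> weights u \<union> weights v"
  using weights_add[of u "scale (-1) v"] weights_scale[of "-1" v] by (auto simp: scale_minus_one)

lemma weights_E: "weights (E p u) \<subseteq> weights u"
  unfolding shifted_partial_def using weights_add weights_partial weights_scale by blast

lemma weights_xmon_mult: "weights (xmon \<alpha> 0 * u) \<subseteq> (+) \<alpha> ` weights u"
  using keys_mult[of "xmon \<alpha> 0" u] by (auto simp: weights_def image_iff) force

lemma nonzero_key:
  assumes "u \<noteq> 0"
  obtains \<beta> j where "(\<beta>, j) \<in> Poly_Mapping.keys u"
proof -
  obtain k where "Poly_Mapping.lookup u k \<noteq> 0"
    using assms by (auto simp: poly_mapping_eq_iff fun_eq_iff)
  then show ?thesis
    using that[of "fst k" "snd k"] by (simp add: in_keys_iff)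
qed

text \<open>One list for all \<open>p\<close>: \<open>quad p\<close> is singular at the first two
  values if \<open>p\<close> is 1 or 2, and at the last two if \<open>p\<close> is 3 or 4.\<close>

definition generic :: "'g set"
  where "generic = {\<tau>. \<forall>p. \<phi> p \<tau> \<notin> {0, \<phi> p \<alpha>\<^sub>0, - \<phi> p \<alpha>\<^sub>0, - 2 * \<phi> p \<alpha>\<^sub>0}}"

lemma generic_eigenvalue:
  assumes "weights u \<subseteq> generic" "u \<noteq> 0" "D p u = scale c u"
  shows "c \<notin> {0, \<phi> p \<alpha>\<^sub>0, - \<phi> p \<alpha>\<^sub>0, - 2 * \<phi> p \<alpha>\<^sub>0}"
proof -
  obtain \<beta> j where k: "(\<beta>, j) \<in> Poly_Mapping.keys u"
    using assms(2) by (rule nonzero_key)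
  have "\<phi> p \<beta> = c"
    by (rule eigenvalue_weight(1)[OF assms(3) k])
  moreover have "\<beta> \<in> generic"
    using imageI[OF k, of fst] assms(1) by (auto simp: weights_def)
  ultimately show ?thesis
    by (auto simp: generic_def)
qed

text \<open>\<open>quad p\<close> is a product of two first-order factors. If it killed
  \<open>u\<close>, then \<open>u\<close> or its image under the first factor would be an
  eigenvector with a non-generic eigenvalue.\<close>

lemma quad_nonzero:
  assumes "weights u \<subseteq> generic" "u \<noteq> 0"
  shows "quad p u \<noteq> 0"
proof
  assume 0: "quad p u = 0"
  define v where "v = E p u - scale (quad_root p) u"
  have weights: "weights v \<subseteq> generic"
    unfolding v_def using weights_diff weights_E weights_scale assms(1) by blast
  have eigen: "D p v = scale (- weight_shift \<phi> \<alpha>\<^sub>0 p) v"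
  proof -
    have "E p v = 0"
      using 0 by (simp only: v_def quad_def E_simps)
    then show ?thesis
      by (simp add: shifted_partial_def scale_uminus_left eq_neg_iff_add_eq_0)
  qed
  have "v = 0"
  proof (rule ccontr)
    assume "v \<noteq> 0"
    from generic_eigenvalue[OF weights this eigen] show False
      by (simp add: weight_shift_def split: if_splits)
  qed
  then have "E p u = scale (quad_root p) u"
    by (simp add: v_def)
  then have "D p u = scale (quad_root p - weight_shift \<phi> \<alpha>\<^sub>0 p) u"
    using scale_add_left[of "quad_root p - weight_shift \<phi> \<alpha>\<^sub>0 p" "weight_shift \<phi> \<alpha>\<^sub>0 p" u]
    by (simp add: shifted_partial_def)
  then show False
    using generic_eigenvalue[OF assms, of p "quad_root p - weight_shift \<phi> \<alpha>\<^sub>0 p"]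
    by (auto simp: weight_shift_def quad_root_def split: if_splits)
qed

text \<open>\<open>quad p u\<close> generates under \<open>E p\<close> a space inside
  \<open>I\<close> on which the operators indexed by \<open>S\<close> keep their eigenvalues; local
  finiteness finds an eigenvector of \<open>D p\<close> there.\<close>

lemma extend_joint_eigenvector:
  assumes I: "ad_stable I" and u: "u \<in> I" "weights u \<subseteq> generic" "u \<noteq> 0"
    and eigen: "\<forall>q\<in>S. \<exists>c. D q u = scale c u"
  shows "\<exists>v\<in>I. weights v \<subseteq> generic \<and> v \<noteq> 0 \<and> (\<forall>q\<in>insert p S. \<exists>c. D q v = scale c v)"
proof -
  obtain \<epsilon> where \<epsilon>: "\<And>q. q \<in> S \<Longrightarrow> D q u = scale (\<epsilon> q) u"
    using eigen by metis
  \<comment> \<open>Demanding all powers of \<open>E p\<close> makes \<open>M\<close> stable under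
    \<open>E p\<close>, which is not known of \<open>I\<close> itself.\<close>
  define M where "M = {w. (\<forall>n. (E p ^^ n) w \<in> I) \<and> weights w \<subseteq> generic
    \<and> (\<forall>q\<in>S. D q w = scale (\<epsilon> q) w)}"
  note sub = linear_subspaceD[OF ad_stableD(1)[OF I]]
  have E_M: "E p w \<in> M" if "w \<in> M" for w
  proof -
    have "(E p ^^ n) (E p w) \<in> I" for n
    proof -
      have "(E p ^^ Suc n) w \<in> I"
        using that unfolding M_def by blast
      then show ?thesis
        by (simp add: funpow_swap1)
    qed
    moreover have "D q (E p w) = scale (\<epsilon> q) (E p w)" if "q \<in> S" for q
    proof -
      have "D q w = scale (\<epsilon> q) w"
        using that \<open>w \<in> M\<close> unfolding M_def by blast
      then show ?thesis
        by (simp add: E_D_commute[symmetric] E_simps)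
    qed
    moreover have "weights (E p w) \<subseteq> generic"
      using that weights_E[of p w] unfolding M_def by blast
    ultimately show ?thesis
      by (simp add: M_def)
  qed
  have lin_M: "w - scale c w' \<in> M" if "w \<in> M" "w' \<in> M" for w w' c
  proof -
    have "weights (w - scale c w') \<subseteq> generic"
      using weights_diff weights_scale that unfolding M_def by blast
    then show ?thesis
      using that by (simp add: M_def E_power_linear sub partial_diff partial_scale scale_diff_right scale_scale
        mult.commute)
  qed
  have "quad p u \<in> M"
  proof -
    have "D q (quad p u) = scale (\<epsilon> q) (quad p u)" if "q \<in> S" for q
      using \<epsilon>[OF that]
      by (simp add: quad_def partial_diff partial_scale scale_diff_right scale_scale
          E_D_commute[symmetric] E_simps mult.commute)
    moreover have "weights (quad p u) \<subseteq> generic"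
      unfolding quad_def using weights_diff weights_E weights_scale u(2) by blast
    ultimately show ?thesis
      using E_power_quad_in[OF I u(1)] by (simp add: M_def)
  qed
  moreover have "D p w - scale c w \<in> M" if "w \<in> M" for c w
  proof -
    have "D p w - scale c w = E p w - scale (c + weight_shift \<phi> \<alpha>\<^sub>0 p) w"
      by (simp add: shifted_partial_def scale_add_left)
    then show ?thesis
      using lin_M[OF E_M] that by simp
  qed
  ultimately obtain c w where w: "w \<in> M" "w \<noteq> 0" "D p w = scale c w"
    using eigenvector_exists[OF _ _ quad_nonzero[OF u(2,3)], where M = M and p = p] by metis
  have "(E p ^^ 0) w \<in> I" "weights w \<subseteq> generic" "\<forall>q\<in>S. D q w = scale (\<epsilon> q) w"
    using w(1) unfolding M_def by blast+
  then show ?thesis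
    using w by (intro bexI[of _ w]) auto
qed

text \<open>All exponents are 0 and all four weights are prescribed; as the \<open>\<phi> p\<close>
  separate points, one monomial remains.\<close>

lemma joint_eigenvector_monomial:
  assumes "u \<noteq> 0" and eigen: "\<And>p. D p u = scale (\<epsilon> p) u"
  obtains \<tau> c where "c \<noteq> 0" "u = scale c (xmon \<tau> 0)" "\<And>p. \<phi> p \<tau> = \<epsilon> p"
proof -
  obtain \<tau> j where k: "(\<tau>, j) \<in> Poly_Mapping.keys u"
    using assms(1) by (rule nonzero_key)
  have j0: "i = 0" if "(\<beta>, i) \<in> Poly_Mapping.keys u" for \<beta> i
    using eigenvalue_weight(2)[OF eigen that] by (simp add: vec_eq_iff)
  have wt: "\<phi> p \<beta> = \<epsilon> p" if "(\<beta>, i) \<in> Poly_Mapping.keys u" for \<beta> i p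
    using eigenvalue_weight(1)[OF eigen that] .
  have "Poly_Mapping.keys u \<subseteq> {(\<tau>, 0)}"
    using j0 wt k by (auto intro!: weight_eqI)
  then have "u = scale (Poly_Mapping.lookup u (\<tau>, 0)) (xmon \<tau> 0)"
    by (intro poly_mapping_eqI) (auto simp: lookup_scale lookup_single when_def in_keys_iff)
  moreover have "Poly_Mapping.lookup u (\<tau>, 0) \<noteq> 0"
    using k j0[OF k] by (simp add: in_keys_iff)
  ultimately show ?thesis
    using that wt[OF k] by blast
qed

lemma generic_monomial_in:
  assumes I: "ad_stable I" and u: "u \<in> I" "weights u \<subseteq> generic" "u \<noteq> 0"
  obtains \<tau> where "\<tau> \<in> generic" "xmon \<tau> 0 \<in> I"
proof -
  define Q where "Q S v \<longleftrightarrow> v \<in> I \<and> weights v \<subseteq> generic \<and> v \<noteq> 0 \<and> (\<forall>q\<in>S. \<exists>c. D q v = scale c v)"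
    for S v
  have ext: "\<exists>v. Q (insert p S) v" if "\<exists>v. Q S v" for p S
    using that extend_joint_eigenvector[OF I] unfolding Q_def by metis
  have "\<exists>v. Q {} v"
    using u unfolding Q_def by blast
  \<comment> \<open>One extension for each of the four derivations, starting from no eigenvector
    condition.\<close>
  from ext[OF ext[OF ext[OF ext[OF this]]], of 4 3 2 1]
  obtain v where v: "v \<in> I" "weights v \<subseteq> generic" "v \<noteq> 0"
    "\<forall>q\<in>{4, 3, 2, 1}. \<exists>c. D q v = scale c v"
    unfolding Q_def by blast
  have "\<exists>c. D q v = scale c v" for q
    using v(4) exhaust_4[of q] by auto
  then obtain \<epsilon> where "\<And>q. D q v = scale (\<epsilon> q) v"
    by metis
  from joint_eigenvector_monomial[OF v(3) this] obtain \<tau> c where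
    \<tau>: "c \<noteq> 0" "v = scale c (xmon \<tau> 0)" by metis
  then have "\<tau> \<in> weights v"
    by (auto simp: weights_def in_keys_iff lookup_scale intro!: image_eqI[where x = "(\<tau>, 0)"])
  moreover have "xmon \<tau> 0 \<in> I"
    by (rule linear_subspace_scaleD[OF ad_stableD(1)[OF I] _ \<tau>(1)]) (use v(1) \<tau>(2) in simp)
  ultimately show ?thesis
    using that v(2) by blast
qed

section \<open>Moving an element to generic weights by one bracket\<close>

lemma multiples_avoid:
  fixes g :: 'f
  assumes "finite B" "g \<noteq> 0"
  obtains N where "\<And>m. m \<ge> N \<Longrightarrow> of_nat m * g \<notin> B"
proof -
  \<comment> \<open>In characteristic 0 different multipliers give different multiples, so only
    finitely many fall into \<open>B\<close>.\<close>
  have "inj (\<lambda>m::nat. of_nat m * g)"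
    using assms(2) by (simp add: inj_def)
  then have "finite ((\<lambda>m::nat. of_nat m * g) -` B)"
    using assms(1) by (intro finite_vimageI)
  then obtain N where "\<forall>m\<in>(\<lambda>m::nat. of_nat m * g) -` B. m < N"
    using finite_nat_set_iff_bounded by blast
  then show ?thesis
    by (intro that[of N]) (auto simp: not_le[symmetric])
qed

lemma br_xmon_eq_0D:
  assumes "br (xmon \<alpha> 0) u = 0"
  shows "xmon \<alpha>\<^sub>0 0 * (scale (\<phi> 1 \<alpha>) (D 2 u) - scale (\<phi> 2 \<alpha>) (D 1 u))
       + (scale (\<phi> 3 \<alpha> + \<phi> 3 \<alpha>\<^sub>0) (E 4 u) - scale (\<phi> 4 \<alpha> + \<phi> 4 \<alpha>\<^sub>0) (E 3 u)) = 0"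
    (is "?w = 0")
proof -
  have "xmon \<alpha> 0 * ?w = 0"
    using assms by (simp only: br_xmon)
  then have "xmon (- \<alpha>) 0 * (xmon \<alpha> 0 * ?w) = 0"
    by simp
  moreover have "xmon (- \<alpha>) 0 * (xmon \<alpha> 0 * v) = v" for v :: "('g, 'f) galg"
    by (simp add: mult.assoc[symmetric] mult_single xmon_zero_mult)
  ultimately show ?thesis
    by metis
qed

text \<open>Lattice points whose four coordinates vary independently.\<close>

definition ax_comb :: "(4 \<Rightarrow> nat) \<Rightarrow> 'g"
  where "ax_comb m = (\<Sum>p\<in>UNIV. ax_mult (m p) p)"

lemma phi_ax_comb: "\<phi> p (ax_comb m) = of_nat (m p) * \<phi> p (ax p)"
  by (simp add: ax_comb_def additive.sum[OF additive] phi_ax_mult)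

text \<open>After removal of the invertible factor x^\<alpha>, the bracket is affine in the four
  weights of \<alpha>. Differences of neighbouring lattice points isolate each \<open>E p u\<close>,
  up to a nonzero scalar and an invertible monomial.\<close>

lemma joint_kernel_of_generic_brackets:
  assumes vanish: "\<And>m. (\<And>p. m p \<ge> N) \<Longrightarrow> br (xmon (ax_comb m) 0) u = 0"
  shows "E p u = 0"
proof -
  define W where "W a b c d = xmon \<alpha>\<^sub>0 0 * (scale a (D 2 u) - scale b (D 1 u))
      + (scale (c + \<phi> 3 \<alpha>\<^sub>0) (E 4 u) - scale (d + \<phi> 4 \<alpha>\<^sub>0) (E 3 u))" for a b c d
  define h where "h n p = of_nat n * \<phi> p (ax p)" for n p
  have W0: "W (h a 1) (h b 2) (h c 3) (h d 4) = 0" if "a \<ge> N" "b \<ge> N" "c \<ge> N" "d \<ge> N" for a b c d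
  proof -
    define m where "m p = (if p = 1 then a else if p = 2 then b else if p = 3 then c else d)" for p :: 4
    have "br (xmon (ax_comb m) 0) u = 0"
      by (rule vanish) (use that in \<open>simp add: m_def\<close>)
    from br_xmon_eq_0D[OF this] show ?thesis
      by (simp add: W_def phi_ax_comb h_def m_def)
  qed
  have h_Suc: "h (Suc N) p = h N p + \<phi> p (ax p)" for p
    by (simp add: h_def algebra_simps)
  have eqs: "scale (\<phi> 1 (ax 1)) (xmon \<alpha>\<^sub>0 0 * D 2 u) = W (h (Suc N) 1) (h N 2) (h N 3) (h N 4) - W (h N 1) (h N 2) (h N 3) (h N 4)"
    "scale (\<phi> 2 (ax 2)) (xmon \<alpha>\<^sub>0 0 * D 1 u) = W (h N 1) (h N 2) (h N 3) (h N 4) - W (h N 1) (h (Suc N) 2) (h N 3) (h N 4)"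
    "scale (\<phi> 3 (ax 3)) (E 4 u) = W (h N 1) (h N 2) (h (Suc N) 3) (h N 4) - W (h N 1) (h N 2) (h N 3) (h N 4)"
    "scale (\<phi> 4 (ax 4)) (E 3 u) = W (h N 1) (h N 2) (h N 3) (h N 4) - W (h N 1) (h N 2) (h N 3) (h (Suc N) 4)"
    unfolding W_def h_Suc
    by (simp_all add: scale_add_left scale_mult_right distrib_left right_diff_distrib)
  have *: "xmon \<alpha>\<^sub>0 0 * D 2 u = 0" and **: "xmon \<alpha>\<^sub>0 0 * D 1 u = 0"
    and 4: "E 4 u = 0" and 3: "E 3 u = 0"
    using eqs ax(1) by (simp_all add: W0 scale_eq_0_iff)
  have cancel: "v = 0" if "xmon \<alpha>\<^sub>0 0 * v = 0" for v :: "('g, 'f) galg"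
  proof -
    have "xmon (- \<alpha>\<^sub>0) 0 * (xmon \<alpha>\<^sub>0 0 * v) = v"
      by (simp add: mult.assoc[symmetric] mult_single xmon_zero_mult)
    with that show ?thesis by simp
  qed
  show ?thesis
    using cancel[OF *] cancel[OF **] 3 4 exhaust_4[of p] by auto
qed

text \<open>All far enough lattice points move the finitely many weights of \<open>u\<close> away
  from the bad values. If all these brackets vanished, every \<open>E p\<close> would kill
  \<open>u\<close>, which would then be a multiple of x^\<sigma>.\<close>

lemma generic_bracket:
  assumes "u \<noteq> 0" and not_sigma: "\<And>\<sigma> c. is_sigma \<phi> \<alpha>\<^sub>0 \<sigma> \<Longrightarrow> u \<noteq> scale c (xmon \<sigma> 0)"
  obtains \<alpha> where "\<not> star \<alpha>" "br (xmon \<alpha> 0) u \<noteq> 0" "weights (br (xmon \<alpha> 0) u) \<subseteq> generic"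
proof -
  define bad where "bad p = {0, \<phi> p \<alpha>\<^sub>0, - \<phi> p \<alpha>\<^sub>0, - 2 * \<phi> p \<alpha>\<^sub>0}" for p
  \<comment> \<open>The two shifted values serve the weights \<alpha>+\<beta> and
    \<open>\<alpha> + (\<alpha>\<^sub>0 + \<beta>)\<close> of the bracket; the inserted value rules
    out \<open>star \<alpha>\<close>.\<close>
  define B where "B p = insert (\<phi> p \<alpha>\<^sub>0)
      (\<Union>\<beta>\<in>weights u. \<Union>b\<in>bad p. {b - \<phi> p \<beta>, b - \<phi> p \<beta> - \<phi> p \<alpha>\<^sub>0})" for p
  have "\<exists>N. \<forall>m\<ge>N. of_nat m * \<phi> p (ax p) \<notin> B p" for p
  proof -
    have "finite (B p)"
      by (simp add: B_def bad_def weights_def)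
    then show ?thesis
      using multiples_avoid[OF _ ax(1)[of p]] by metis
  qed
  then obtain N where N: "\<And>p m. m \<ge> N p \<Longrightarrow> of_nat m * \<phi> p (ax p) \<notin> B p"
    by metis
  \<comment> \<open>A sum of natural numbers is a common bound for all four thresholds.\<close>
  define M where "M = (\<Sum>p\<in>UNIV. N p)"
  have NM: "N p \<le> M" for p
    unfolding M_def by (rule member_le_sum) auto
  have avoid: "\<phi> p (ax_comb m) \<notin> B p" if "\<And>p. m p \<ge> M" for p m
    using N[OF order_trans[OF NM that]] by (simp add: phi_ax_comb)
  have "\<exists>m. (\<forall>p. m p \<ge> M) \<and> br (xmon (ax_comb m) 0) u \<noteq> 0"
  proof (rule ccontr)
    assume "\<not> ?thesis"
    then have "E p u = 0" for p
      using joint_kernel_of_generic_brackets[of M u p] by blast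
    then have "D p u = scale (- weight_shift \<phi> \<alpha>\<^sub>0 p) u" for p
      by (simp add: shifted_partial_def scale_uminus_left eq_neg_iff_add_eq_0)
    from joint_eigenvector_monomial[OF assms(1) this] obtain \<sigma> c where
      \<sigma>: "u = scale c (xmon \<sigma> 0)" "\<And>p. \<phi> p \<sigma> = - weight_shift \<phi> \<alpha>\<^sub>0 p"
      by metis
    have "is_sigma \<phi> \<alpha>\<^sub>0 \<sigma>"
      by (simp add: is_sigma_def ker_def \<sigma>(2))
    with not_sigma \<sigma>(1) show False
      by blast
  qed
  then obtain m where m: "\<And>p. m p \<ge> M" "br (xmon (ax_comb m) 0) u \<noteq> 0"
    by blast
  define \<alpha> where "\<alpha> = ax_comb m"
  have "weights (br (xmon \<alpha> 0) u) \<subseteq> (+) \<alpha> ` ((+) \<alpha>\<^sub>0 ` weights u \<union> weights u)"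
  proof -
    have "weights (scale a (E p u) - scale b (E q u)) \<subseteq> weights u" for a b p q
      using weights_diff weights_scale weights_E by blast
    note w = this[of _ 2 _ 1] this[of _ 4 _ 3]
    show ?thesis
      unfolding br_xmon
      by (rule order_trans[OF weights_xmon_mult image_mono[OF order_trans[OF weights_add]]])
        (rule Un_mono[OF order_trans[OF weights_xmon_mult image_mono]]; use w in simp)
  qed
  moreover have "\<alpha> + \<beta> \<in> generic" "\<alpha> + (\<alpha>\<^sub>0 + \<beta>) \<in> generic" if "\<beta> \<in> weights u" for \<beta>
  proof -
    have *: "\<phi> p \<alpha> \<noteq> b - \<phi> p \<beta>" "\<phi> p \<alpha> \<noteq> b - \<phi> p \<beta> - \<phi> p \<alpha>\<^sub>0" if "b \<in> bad p" for p b
      using avoid[OF m(1), of p] \<open>\<beta> \<in> weights u\<close> that by (auto simp: B_def \<alpha>_def)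
    have "\<phi> p (\<alpha> + \<beta>) \<notin> bad p" "\<phi> p (\<alpha> + (\<alpha>\<^sub>0 + \<beta>)) \<notin> bad p" for p
      using *(1)[of "\<phi> p (\<alpha> + \<beta>)" p] *(2)[of "\<phi> p (\<alpha> + (\<alpha>\<^sub>0 + \<beta>))" p] by auto
    then show "\<alpha> + \<beta> \<in> generic" "\<alpha> + (\<alpha>\<^sub>0 + \<beta>) \<in> generic"
      by (simp_all only: generic_def bad_def mem_Collect_eq simp_thms)
  qed
  ultimately have "weights (br (xmon \<alpha> 0) u) \<subseteq> generic"
    by blast
  moreover have "\<not> star \<alpha>"
    using avoid[OF m(1), of 1] by (simp add: star_cond_def B_def \<alpha>_def)
  ultimately show ?thesis
    using that[of \<alpha>] m(2) by (simp add: \<alpha>_def)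
qed

section \<open>From one monomial to the images of the operators
  \<open>D p + d_shift p\<close>\<close>

lemma D_xmon: "D p (xmon \<tau> 0) = scale (\<phi> p \<tau>) (xmon \<tau> 0)"
  by (rule partial_xmon_zero)

lemma E_xmon: "E p (xmon \<tau> 0) = scale (\<phi> p \<tau> + weight_shift \<phi> \<alpha>\<^sub>0 p) (xmon \<tau> 0)"
  by (simp add: shifted_partial_def D_xmon scale_add_left)

lemma xmon_shift: "xmon \<alpha> 0 * xmon \<beta> i = (xmon (\<alpha> + \<beta>) i :: ('g, 'f) galg)"
  by (simp add: mult_single)

text \<open>The two arguments have opposite first and second weights, so their determinant vanishes
  and only the monomial without the extra \<open>\<alpha>\<^sub>0\<close> survives.\<close>

lemma br_to_12:
  assumes "\<phi> 1 \<kappa> = 0" "\<phi> 2 \<kappa> = 0"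
  shows "br (xmon (\<kappa> - \<tau>) 0) (xmon \<tau> 0) =
    scale ((\<phi> 3 \<kappa> + 2 * \<phi> 3 \<alpha>\<^sub>0) * (\<phi> 4 \<tau> + \<phi> 4 \<alpha>\<^sub>0) - (\<phi> 4 \<kappa> + 2 * \<phi> 4 \<alpha>\<^sub>0) * (\<phi> 3 \<tau> + \<phi> 3 \<alpha>\<^sub>0))
      (xmon \<kappa> 0)"
proof -
  have "br (xmon (\<kappa> - \<tau>) 0) (xmon \<tau> 0) =
    scale ((\<phi> 3 (\<kappa> - \<tau>) + \<phi> 3 \<alpha>\<^sub>0) * (\<phi> 4 \<tau> + \<phi> 4 \<alpha>\<^sub>0)
        - (\<phi> 4 (\<kappa> - \<tau>) + \<phi> 4 \<alpha>\<^sub>0) * (\<phi> 3 \<tau> + \<phi> 3 \<alpha>\<^sub>0)) (xmon \<kappa> 0)"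
    (is "_ = scale (?a - ?b) _")
  proof -
    have "scale (- (\<phi> 1 \<tau>) * \<phi> 2 \<tau>) v - scale (- (\<phi> 2 \<tau>) * \<phi> 1 \<tau>) v = 0" for v :: "('g, 'f) galg"
      by (simp add: mult.commute)
    then have "br (xmon (\<kappa> - \<tau>) 0) (xmon \<tau> 0)
        = xmon (\<kappa> - \<tau>) 0 * (scale ?a (xmon \<tau> 0) - scale ?b (xmon \<tau> 0))"
      using assms by (simp add: br_xmon D_xmon E_xmon scale_scale)
    also have "\<dots> = scale ?a (xmon \<kappa> 0) - scale ?b (xmon \<kappa> 0)"
      by (simp only: right_diff_distrib scale_mult_right xmon_shift diff_add_cancel)
    also have "\<dots> = scale (?a - ?b) (xmon \<kappa> 0)"
      using scale_add_left[of "?a - ?b" ?b "xmon \<kappa> 0"] by (simp only: diff_add_cancel add_diff_cancel_right')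
    finally show ?thesis .
  qed
  then show ?thesis
    by (simp add: algebra_simps)
qed

text \<open>The coefficient in \<open>br_to_12\<close> is affine in \<open>m\<close> with nonzero
  slope, so it is nonzero for all large \<open>m\<close>.\<close>

lemma large_axis_monomials:
  assumes I: "ad_stable I" and \<tau>: "\<tau> \<in> generic" "xmon \<tau> 0 \<in> I" and p: "p \<in> {3, 4}"
  obtains N where "\<And>m. m \<ge> N \<Longrightarrow> xmon (ax_mult m p) 0 \<in> I"
proof -
  define T where "T q = \<phi> q \<tau> + \<phi> q \<alpha>\<^sub>0" for q
  \<comment> \<open>Up to the factor \<open>\<phi> p (ax p)\<close> this is the slope; it is nonzero
    because \<tau> is generic.\<close>
  define s where "s = (if p = 3 then T 4 else - T 3)"
  have "T 3 \<noteq> 0" "T 4 \<noteq> 0"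
    using \<tau>(1) by (auto simp: generic_def T_def eq_neg_iff_add_eq_0)
  then have s: "\<phi> p (ax p) * s \<noteq> 0"
    using ax(1)[of p] by (simp add: s_def)
  define k where "k = 2 * \<phi> 3 \<alpha>\<^sub>0 * T 4 - 2 * \<phi> 4 \<alpha>\<^sub>0 * T 3"
  obtain N where N: "\<And>m. m \<ge> N \<Longrightarrow> of_nat m * (\<phi> p (ax p) * s) \<notin> {- k}"
    using multiples_avoid[OF _ s, of "{- k}"] by blast
  have "xmon (ax_mult m p) 0 \<in> I" if "m \<ge> N" for m
  proof -
    have p12: "1 \<noteq> p" "2 \<noteq> p"
      using p by auto
    \<comment> \<open>Along \<open>ax p\<close> the first weight stays 0, so \<open>star\<close>
      would force this excluded equality.\<close>
    have "\<phi> 1 \<tau> \<noteq> - \<phi> 1 \<alpha>\<^sub>0"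
      using \<tau>(1) by (auto simp: generic_def)
    then have "\<not> star (ax_mult m p - \<tau>)"
      using p12 by (auto simp: star_cond_def phi_ax_mult eq_neg_iff_add_eq_0 neg_eq_iff_add_eq_0 diff_eq_eq add.commute)
    then have "br (xmon (ax_mult m p - \<tau>) 0) (xmon \<tau> 0) \<in> I"
      using ad_stableD(2)[OF I] \<tau>(2) by blast
    moreover have "br (xmon (ax_mult m p - \<tau>) 0) (xmon \<tau> 0)
        = scale (of_nat m * (\<phi> p (ax p) * s) + k) (xmon (ax_mult m p) 0)"
    proof -
      have "(\<phi> 3 (ax_mult m p) + 2 * \<phi> 3 \<alpha>\<^sub>0) * (\<phi> 4 \<tau> + \<phi> 4 \<alpha>\<^sub>0)
          - (\<phi> 4 (ax_mult m p) + 2 * \<phi> 4 \<alpha>\<^sub>0) * (\<phi> 3 \<tau> + \<phi> 3 \<alpha>\<^sub>0)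
          = of_nat m * (\<phi> p (ax p) * s) + k"
        using p by (auto simp: phi_ax_mult s_def k_def T_def algebra_simps)
      moreover have "\<phi> 1 (ax_mult m p) = 0" "\<phi> 2 (ax_mult m p) = 0"
        using p12 by (simp_all add: phi_ax_mult)
      ultimately show ?thesis
        by (simp only: br_to_12)
    qed
    moreover have "of_nat m * (\<phi> p (ax p) * s) + k \<noteq> 0"
      using N[OF that] by (simp add: eq_neg_iff_add_eq_0)
    ultimately show ?thesis
      using linear_subspace_scaleD[OF ad_stableD(1)[OF I]] by metis
  qed
  then show ?thesis
    using that by blast
qed

text \<open>\<open>star\<close> prescribes the weight at \<open>p\<close>, while that weight changes
  with \<open>m\<close>. The set \<open>B\<close> holds the prescriptions for both kinds of
  index.\<close>

lemma eventually_not_star: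
  obtains N where "\<And>m. m \<ge> N \<Longrightarrow> \<not> star (\<tau> - ax_mult m p)"
proof -
  define B where "B = {\<phi> p \<tau> - \<phi> p \<alpha>\<^sub>0, \<phi> p \<tau> + 2 * \<phi> p \<alpha>\<^sub>0}"
  obtain N where N: "\<And>m. m \<ge> N \<Longrightarrow> of_nat m * \<phi> p (ax p) \<notin> B"
    using multiples_avoid[OF _ ax(1)[of p], of B] by (auto simp: B_def)
  have "\<not> star (\<tau> - ax_mult m p)" if "m \<ge> N" for m
  proof
    assume star: "star (\<tau> - ax_mult m p)"
    have "of_nat m * \<phi> p (ax p) \<in> B"
      using star exhaust_4[of p] by (auto simp: star_cond_def B_def phi_ax_mult algebra_simps)
    with N[OF that] show False ..
  qed
  then show ?thesis
    using that by blast
qed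

text \<open>Chosen so that \<open>D p + d_shift p\<close> is \<open>E p - quad_root p\<close>. These
  operators all kill x^\<tau> exactly when \<open>star \<tau>\<close>.\<close>

definition d_shift :: "4 \<Rightarrow> 'f"
  where "d_shift p = (if p \<in> {1, 2} then - \<phi> p \<alpha>\<^sub>0 else 2 * \<phi> p \<alpha>\<^sub>0)"

lemma star_iff_d_shift: "star \<tau> \<longleftrightarrow> (\<forall>p. \<phi> p \<tau> + d_shift p = 0)"
  unfolding forall_4 by (simp add: star_cond_def d_shift_def)

lemma E_minus_quad_root: "E p v - scale (quad_root p) v = D p v + scale (d_shift p) v"
proof -
  have "d_shift p = weight_shift \<phi> \<alpha>\<^sub>0 p - quad_root p"
    by (simp add: d_shift_def weight_shift_def quad_root_def)
  then show ?thesis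
    using scale_add_left[of "d_shift p" "quad_root p" v] by (simp add: shifted_partial_def)
qed

text \<open>The pair \<open>(r, s)\<close> stands for \<open>(3, 4)\<close>, with \<open>\<beta> = 0\<close>, or for \<open>(1, 2)\<close>, with \<open>\<beta> = \<alpha>\<^sub>0\<close>.\<close>

definition paired :: "4 \<Rightarrow> 4 \<Rightarrow> 'g \<Rightarrow> bool"
  where "paired r s \<beta> \<longleftrightarrow> r = 3 \<and> s = 4 \<and> \<beta> = 0 \<or> r = 1 \<and> s = 2 \<and> \<beta> = \<alpha>\<^sub>0"

lemma br_paired:
  assumes "paired r s \<beta>" "\<And>p. p \<noteq> r \<Longrightarrow> p \<noteq> s \<Longrightarrow> \<phi> p \<kappa> = 0"
  shows "br (xmon (\<kappa> - \<beta>) 0) v = xmon \<kappa> 0 *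
    (scale (\<phi> r \<kappa> - quad_root r) (E s v) - scale (\<phi> s \<kappa> - quad_root s) (E r v))"
  using assms unfolding paired_def
  by (elim disjE) (auto simp: br_xmon_12 br_xmon_34 quad_root_simps)

text \<open>The weights \<kappa> cancel between the two monomials, so the bracket stays on
  \<open>xmon \<tau> i\<close> and depends on \<kappa> only through scalars. The products of two
  weights of \<kappa> cancel, leaving an affine expression.\<close>

lemma paired_operator_in:
  assumes I: "ad_stable I" and i: "i \<in> vecJ J" and rs: "paired r s \<beta>"
    and \<kappa>: "\<And>p. p \<noteq> r \<Longrightarrow> p \<noteq> s \<Longrightarrow> \<phi> p \<kappa> = 0" "xmon (\<kappa> - \<beta>) 0 \<in> I" "\<not> star (\<tau> - \<kappa>)"
  shows "scale (\<phi> r \<kappa>) (E s (xmon \<tau> i) - scale (quad_root s) (xmon \<tau> i))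
    - scale (\<phi> s \<kappa>) (E r (xmon \<tau> i) - scale (quad_root r) (xmon \<tau> i))
    - (scale (quad_root r) (E s (xmon \<tau> i)) - scale (quad_root s) (E r (xmon \<tau> i))) \<in> I"
    (is "?R \<in> I")
proof -
  define h :: "('g, 'f) galg" where "h = xmon \<tau> i"
  have h: "xmon (\<tau> - \<kappa>) i = xmon (- \<kappa>) 0 * h"
    by (simp add: h_def xmon_shift)
  have cancel: "xmon \<kappa> 0 * (xmon (- \<kappa>) 0 * v) = v" for v :: "('g, 'f) galg"
    by (simp add: mult.assoc[symmetric] mult_single xmon_zero_mult)
  have br_\<kappa>: "br (xmon (\<kappa> - \<beta>) 0) v = xmon \<kappa> 0 *
      (scale (\<phi> r \<kappa> - quad_root r) (E s v) - scale (\<phi> s \<kappa> - quad_root s) (E r v))" for v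
    by (rule br_paired[OF rs]) (rule \<kappa>(1))
  have in_I: "br (xmon (\<tau> - \<kappa>) i) (xmon (\<kappa> - \<beta>) 0) \<in> I"
    by (rule ad_stableD(3)[OF I \<kappa>(3) i \<kappa>(2)])
  \<comment> \<open>The known element of \<open>I\<close> is turned into the acting one by skew
    symmetry, since its adjoint action has the simple form \<open>br_\<kappa>\<close>.\<close>
  have "br (xmon (\<tau> - \<kappa>) i) (xmon (\<kappa> - \<beta>) 0) = - br (xmon (\<kappa> - \<beta>) 0) (xmon (- \<kappa>) 0 * h)"
    unfolding h by (rule bracket2_skew)
  also have "br (xmon (\<kappa> - \<beta>) 0) (xmon (- \<kappa>) 0 * h) =
      scale (\<phi> r \<kappa> - quad_root r) (E s h - scale (\<phi> s \<kappa>) h)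
      - scale (\<phi> s \<kappa> - quad_root s) (E r h - scale (\<phi> r \<kappa>) h)"
    unfolding br_\<kappa> E_xmon_mult
    by (simp only: scale_mult_right right_diff_distrib cancel phi_simps scale_uminus_left
        add_uminus_conv_diff)
  also have "\<dots> = scale (\<phi> r \<kappa>) (E s h - scale (quad_root s) h)
    - scale (\<phi> s \<kappa>) (E r h - scale (quad_root r) h)
    - (scale (quad_root r) (E s h) - scale (quad_root s) (E r h))"
    by (simp only: scale_diff_left scale_diff_right scale_scale mult.commute)
      (simp only: scale_diff_left algebra_simps)
  finally have eq: "br (xmon (\<tau> - \<kappa>) i) (xmon (\<kappa> - \<beta>) 0) = - ?R"
    unfolding h_def .
  from in_I have "- ?R \<in> I"
    unfolding eq .
  then have "scale (- 1) (- ?R) \<in> I"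
    by (rule linear_subspaceD(3)[OF ad_stableD(1)[OF I]])
  then show ?thesis
    by (simp only: scale_minus_one minus_minus)
qed

text \<open>Two consecutive multiples of \<open>ax q\<close> in \<open>paired_operator_in\<close>:
  in the difference the constant part cancels and a nonzero multiple of
  \<open>E p - quad_root p\<close> is left.\<close>

lemma D_shift_in:
  assumes I: "ad_stable I" and i: "i \<in> vecJ J" and rs: "paired r s \<beta>"
    and pq: "(p, q) = (s, r) \<or> (p, q) = (r, s)"
    and large: "\<And>m. m \<ge> N \<Longrightarrow> xmon (ax_mult m q - \<beta>) 0 \<in> I"
  shows "D p (xmon \<tau> i) + scale (d_shift p) (xmon \<tau> i) \<in> I"
proof -
  define h :: "('g, 'f) galg" where "h = xmon \<tau> i"
  note sub = linear_subspaceD[OF ad_stableD(1)[OF I]]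
  obtain M where M: "\<And>m. m \<ge> M \<Longrightarrow> \<not> star (\<tau> - ax_mult m q)"
    using eventually_not_star by blast
  define R where "R \<kappa> = scale (\<phi> r \<kappa>) (E s h - scale (quad_root s) h)
    - scale (\<phi> s \<kappa>) (E r h - scale (quad_root r) h)
    - (scale (quad_root r) (E s h) - scale (quad_root s) (E r h))" for \<kappa>
  define n where "n = max M N"
  have R: "R (ax_mult m q) \<in> I" if "m \<ge> n" for m
    unfolding R_def h_def
    by (rule paired_operator_in[OF I i rs])
      (use pq that large[of m] M[of m] in \<open>auto simp: n_def phi_ax_mult\<close>)
  have rs': "r \<noteq> s"
    using rs by (auto simp: paired_def)
  have "R (ax_mult (Suc n) q) - R (ax_mult n q) \<in> I"
    by (intro sub(4) R) simp_all
  moreover have "R (ax_mult (Suc n) q) - R (ax_mult n q)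
      = scale (if q = r then \<phi> q (ax q) else - \<phi> q (ax q)) (E p h - scale (quad_root p) h)"
  proof -
    have S: "scale (of_nat (Suc n) * c) v = scale (of_nat n * c) v + scale c v" for c and v :: "('g, 'f) galg"
      by (simp only: of_nat_Suc distrib_right mult_1 scale_add_left add.commute)
    consider "p = s" "q = r" | "p = r" "q = s"
      using pq by blast
    then show ?thesis
      by cases (use rs' in \<open>simp_all only: R_def phi_ax_mult S refl if_True if_False not_sym
        scale_zero_left\<close>, simp_all add: scale_uminus_left)
  qed
  ultimately have "scale (if q = r then \<phi> q (ax q) else - \<phi> q (ax q)) (E p h - scale (quad_root p) h) \<in> I"
    by simp
  then have "E p h - scale (quad_root p) h \<in> I"
    by (rule linear_subspace_scaleD[OF ad_stableD(1)[OF I]]) (simp add: ax(1))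
  then show ?thesis
    by (simp add: E_minus_quad_root h_def)
qed

text \<open>The pair (3, 4) is settled first, starting from the large axis monomials; its result
  supplies the monomials needed for the pair (1, 2).\<close>

lemma D_shift_all_in:
  assumes I: "ad_stable I" and \<tau>: "\<tau> \<in> generic" "xmon \<tau> 0 \<in> I" and i: "i \<in> vecJ J"
  shows "D p (xmon \<beta> i) + scale (d_shift p) (xmon \<beta> i) \<in> I"
proof -
  have rs34: "paired 3 4 0" and rs12: "paired 1 2 \<alpha>\<^sub>0"
    by (simp_all add: paired_def)
  have in34: "D p (xmon \<beta> i) + scale (d_shift p) (xmon \<beta> i) \<in> I"
    if i: "i \<in> vecJ J" and pq: "(p, q) = (4, 3) \<or> (p, q) = (3, 4)" for \<beta> i p and q :: 4
  proof -
    obtain N where N: "\<And>m. m \<ge> N \<Longrightarrow> xmon (ax_mult m q) 0 \<in> I"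
      using large_axis_monomials[OF I \<tau>, of q] pq by auto
    show ?thesis
      by (rule D_shift_in[OF I i rs34 pq, of N]) (simp add: N)
  qed
  \<comment> \<open>On these monomials the operators for \<open>p\<close> equal to 3 and 4 act as
    the scalars \<open>\<phi> p \<alpha>\<^sub>0\<close>, not both 0.\<close>
  have mon: "xmon (\<delta> - \<alpha>\<^sub>0) 0 \<in> I" if "\<phi> 3 \<delta> = 0" "\<phi> 4 \<delta> = 0" for \<delta>
  proof -
    have "scale (\<phi> p \<alpha>\<^sub>0) (xmon (\<delta> - \<alpha>\<^sub>0) 0) \<in> I" if "(p, q) = (4, 3) \<or> (p, q) = (3, 4)" for p and q :: 4
    proof -
      have "D p (xmon (\<delta> - \<alpha>\<^sub>0) 0) + scale (d_shift p) (xmon (\<delta> - \<alpha>\<^sub>0) 0) = scale (\<phi> p \<alpha>\<^sub>0) (xmon (\<delta> - \<alpha>\<^sub>0) 0)"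
        using that \<open>\<phi> 3 \<delta> = 0\<close> \<open>\<phi> 4 \<delta> = 0\<close> by (auto simp: D_xmon d_shift_def simp flip: scale_add_left)
      with in34[OF zero_in_vecJ that, of "\<delta> - \<alpha>\<^sub>0"] show ?thesis by simp
    qed
    then show ?thesis
      using alpha0_34 linear_subspace_scaleD[OF ad_stableD(1)[OF I]] by blast
  qed
  have in12: "D p (xmon \<beta> i) + scale (d_shift p) (xmon \<beta> i) \<in> I"
    if pq: "(p, q) = (2, 1) \<or> (p, q) = (1, 2)" for \<beta> p and q :: 4
    by (rule D_shift_in[OF I i rs12 pq, of 0], rule mon) (use pq in \<open>auto simp: phi_ax_mult\<close>)
  show ?thesis
    using in34[OF i, of p] in12[of p] exhaust_4[of p] by blast
qed

text \<open>Where \<open>J p = {0}\<close> the entry is 0, and truncated subtraction keeps it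
  0.\<close>

lemma vecJ_pred: "i \<in> vecJ J \<Longrightarrow> i - axis p 1 \<in> vecJ J"
  using J by (auto simp: vecJ_def axis_def) (metis diff_0_eq_0 singleton_iff UNIV_I)+

text \<open>\<open>D p + d_shift p\<close> maps a monomial to a multiple of itself plus a lowered
  one. If some such multiple is nonzero, induction on the exponent at \<open>p\<close> gives all
  monomials over \<beta>.\<close>

lemma monomials_in_ad_stable:
  assumes I: "ad_stable I" and u: "u \<in> I" "u \<noteq> 0"
    and not_sigma: "\<And>\<sigma> c. is_sigma \<phi> \<alpha>\<^sub>0 \<sigma> \<Longrightarrow> u \<noteq> scale c (xmon \<sigma> 0)"
    and i: "i \<in> vecJ J" and exception: "\<not> star \<beta> \<or> vecJ J \<noteq> {0}"
  shows "xmon \<beta> i \<in> I"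
proof -
  obtain \<alpha> where \<alpha>: "\<not> star \<alpha>" "br (xmon \<alpha> 0) u \<noteq> 0" "weights (br (xmon \<alpha> 0) u) \<subseteq> generic"
    using generic_bracket[OF u(2) not_sigma] by blast
  obtain \<tau> where \<tau>: "\<tau> \<in> generic" "xmon \<tau> 0 \<in> I"
    using generic_monomial_in[OF I ad_stableD(2)[OF I \<alpha>(1) u(1)] \<alpha>(3,2)] by blast
  note D_in = D_shift_all_in[OF I \<tau>]
  note sub = linear_subspaceD[OF ad_stableD(1)[OF I]] linear_subspace_scaleD[OF ad_stableD(1)[OF I]]
  have eq: "D p (xmon \<beta> i) + scale (d_shift p) (xmon \<beta> i)
      = scale (\<phi> p \<beta> + d_shift p) (xmon \<beta> i) + scale (of_nat (i $ p)) (xmon \<beta> (i - axis p 1))" for p i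
    by (simp add: partial_xmon scale_add_left)
  show ?thesis
  proof (cases "star \<beta>")
    case False
    then obtain p where p: "\<phi> p \<beta> + d_shift p \<noteq> 0"
      by (auto simp: star_iff_d_shift)
    from i show ?thesis
    proof (induction "i $ p" arbitrary: i rule: less_induct)
      case less
      have lower: "scale (of_nat (i $ p)) (xmon \<beta> (i - axis p 1)) \<in> I"
      proof (cases "i $ p = 0")
        case False
        then have "(i - axis p 1) $ p < i $ p"
          by (simp add: axis_def)
        then show ?thesis
          using less vecJ_pred sub(3) by blast
      qed (simp add: sub)
      from sub(4)[OF D_in[OF less.prems, of p \<beta>] lower]
      have "scale (\<phi> p \<beta> + d_shift p) (xmon \<beta> i) \<in> I"
        unfolding eq by simp
      then show ?case
        by (rule sub(5)) (rule p)
    qed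
  next
    case True
    with exception have "vecJ J \<noteq> {0}" by blast
    then obtain p where p: "J p = UNIV"
      using J zero_in_vecJ by (fastforce simp: vecJ_def vec_eq_iff)
    \<comment> \<open>Here only the lowering term survives, so the monomial is reached from one
      exponent above.\<close>
    have "i + axis p 1 \<in> vecJ J"
      using i p J by (auto simp: vecJ_def axis_def)
    from D_in[OF this, of p \<beta>] have "scale (of_nat (Suc (i $ p))) (xmon \<beta> i) \<in> I"
      using True unfolding eq by (simp add: star_iff_d_shift axis_def)
    then show ?thesis
      by (rule sub(5)) (rule of_nat_neq_0)
  qed
qed

section \<open>The quotient \<open>B\<^sub>4\<close>\<close>

abbreviation "A4_set \<equiv> {u :: ('g, 'f) galg. Poly_Mapping.keys u \<subseteq> UNIV \<times> vecJ J}"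
abbreviation "quot \<equiv> toB4 J \<phi> \<alpha>\<^sub>0"
abbreviation "B \<equiv> B4 J \<phi> \<alpha>\<^sub>0"
abbreviation "Fs \<equiv> F_sigma J \<phi> \<alpha>\<^sub>0"

lemma A4_eq: "A4 J \<phi> \<alpha>\<^sub>0 = lie_on \<phi> \<alpha>\<^sub>0 A4_set"
  by (simp add: A4_def lie_on_def)

section \<open>Closure properties of the carrier of \<open>A4\<close>\<close>

lemma A4_set_iff: "u \<in> A4_set \<longleftrightarrow> (\<forall>\<beta> j. Poly_Mapping.lookup u (\<beta>, j) \<noteq> 0 \<longrightarrow> j \<in> vecJ J)"
  by (auto simp: in_keys_iff)

lemma linear_subspace_A4_set: "linear_subspace A4_set"
  unfolding linear_subspace_def
proof (intro conjI ballI allI)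
  fix u v :: "('g, 'f) galg" assume "u \<in> A4_set" "v \<in> A4_set"
  then show "u + v \<in> A4_set"
    using keys_add[of u v] by blast
next
  fix c and u :: "('g, 'f) galg" assume "u \<in> A4_set"
  then show "scale c u \<in> A4_set"
    using keys_scale_subset[of c u] by blast
qed simp

lemma vecJ_add: "i \<in> vecJ J \<Longrightarrow> j \<in> vecJ J \<Longrightarrow> i + j \<in> vecJ J"
  unfolding vecJ_def
proof (intro CollectI allI)
  fix p assume ij: "i \<in> {i. \<forall>p. i $ p \<in> J p}" "j \<in> {i. \<forall>p. i $ p \<in> J p}"
  then have "i $ p \<in> J p" "j $ p \<in> J p"
    by blast+
  then show "(i + j) $ p \<in> J p"
    using J[of p] by auto
qed

lemma mult_A4_set:
  assumes uv: "u \<in> A4_set" "v \<in> A4_set"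
  shows "u * v \<in> A4_set"
proof (intro CollectI subsetI)
  fix k assume "k \<in> Poly_Mapping.keys (u * v)"
  then obtain a b where "k = a + b" "a \<in> Poly_Mapping.keys u" "b \<in> Poly_Mapping.keys v"
    using keys_mult[of u v] by blast
  moreover from this have "snd a \<in> vecJ J" "snd b \<in> vecJ J"
    using uv by auto
  ultimately show "k \<in> UNIV \<times> vecJ J"
    using vecJ_add by (simp add: mem_Times_iff)
qed

lemma partial_A4_set:
  assumes u: "u \<in> A4_set"
  shows "D p u \<in> A4_set"
  unfolding A4_set_iff
proof (intro allI impI)
  fix \<beta> j assume "Poly_Mapping.lookup (D p u) (\<beta>, j) \<noteq> 0"
  then have "Poly_Mapping.lookup u (\<beta>, j) \<noteq> 0 \<or> Poly_Mapping.lookup u (\<beta>, j + axis p 1) \<noteq> 0"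
    by (auto simp: lookup_partial)
  then have "j \<in> vecJ J \<or> j + axis p 1 \<in> vecJ J"
    using u unfolding A4_set_iff by blast
  then show "j \<in> vecJ J"
    using vecJ_pred[of "j + axis p 1" p] by auto
qed

lemma xmon_A4_set: "i \<in> vecJ J \<Longrightarrow> xmon \<alpha> i \<in> A4_set"
  by simp

lemma bracket_A4_set: "u \<in> A4_set \<Longrightarrow> v \<in> A4_set \<Longrightarrow> br u v \<in> A4_set"
proof -
  note sub = linear_subspaceD[OF linear_subspace_A4_set]
  assume uv: "u \<in> A4_set" "v \<in> A4_set"
  have "E p w \<in> A4_set" if "w \<in> A4_set" for p w
    unfolding shifted_partial_def by (intro sub partial_A4_set that)
  with uv show ?thesis
    unfolding bracket2_eq
    by (intro sub(2,4) mult_A4_set partial_A4_set xmon_A4_set zero_in_vecJ)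
qed

section \<open>The central line and its cosets\<close>

lemma sigma_unique: "is_sigma \<phi> \<alpha>\<^sub>0 \<sigma> \<Longrightarrow> is_sigma \<phi> \<alpha>\<^sub>0 \<sigma>' \<Longrightarrow> \<sigma> = \<sigma>'"
  by (rule weight_eqI4) (auto simp: is_sigma_def ker_def add_eq_0_iff2)

lemma x_sigma_eq:
  assumes "is_sigma \<phi> \<alpha>\<^sub>0 \<sigma>"
  shows "x_sigma \<phi> \<alpha>\<^sub>0 = xmon \<sigma> 0"
proof -
  have "(THE \<sigma>. is_sigma \<phi> \<alpha>\<^sub>0 \<sigma>) = \<sigma>"
    using assms by (rule the_equality) (rule sigma_unique[OF _ assms])
  then show ?thesis
    using assms unfolding x_sigma_def by auto
qed

lemma F_sigma_eq: "Fs = range (\<lambda>c. scale c (x_sigma \<phi> \<alpha>\<^sub>0))"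
  by (auto simp: F_sigma_def line_def A4_eq)

lemma not_in_F_sigma:
  assumes "u \<notin> Fs"
  shows "u \<noteq> 0" and "is_sigma \<phi> \<alpha>\<^sub>0 \<sigma> \<Longrightarrow> u \<noteq> scale c (xmon \<sigma> 0)"
proof -
  have *: "u \<noteq> scale c (x_sigma \<phi> \<alpha>\<^sub>0)" for c
    using assms unfolding F_sigma_eq by blast
  from this[of 0] show "u \<noteq> 0"
    by simp
  show "is_sigma \<phi> \<alpha>\<^sub>0 \<sigma> \<Longrightarrow> u \<noteq> scale c (xmon \<sigma> 0)"
    using *[of c] by (simp add: x_sigma_eq)
qed

text \<open>If no \<sigma> exists, \<open>x_sigma\<close> has the default value 0, so a nonzero
  element of \<open>Fs\<close> yields a \<sigma>.\<close>

lemma F_sigma_cases: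
  assumes "u \<in> Fs" "u \<noteq> 0"
  obtains \<sigma> c where "is_sigma \<phi> \<alpha>\<^sub>0 \<sigma>" "u = scale c (xmon \<sigma> 0)"
proof -
  obtain c where c: "u = scale c (x_sigma \<phi> \<alpha>\<^sub>0)"
    using assms(1) unfolding F_sigma_eq by blast
  show ?thesis
  proof (cases "\<exists>\<sigma>. is_sigma \<phi> \<alpha>\<^sub>0 \<sigma>")
    case True
    then obtain \<sigma> where "is_sigma \<phi> \<alpha>\<^sub>0 \<sigma>" ..
    with that c show ?thesis
      by (simp add: x_sigma_eq)
  next
    case False
    then have "x_sigma \<phi> \<alpha>\<^sub>0 = 0"
      unfolding x_sigma_def by (rule if_not_P)
    then have "u = 0"
      by (simp add: c)
    with assms(2) show ?thesis ..
  qed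
qed

lemma linear_subspace_line: "linear_subspace (range (\<lambda>c. scale c x))"
  for x :: "('g, 'f) galg"
  unfolding linear_subspace_def
proof (intro conjI ballI allI)
  show "0 \<in> range (\<lambda>c. scale c x)"
    by (rule range_eqI[of _ _ 0]) simp
next
  fix u v assume "u \<in> range (\<lambda>c. scale c x)" "v \<in> range (\<lambda>c. scale c x)"
  then obtain c d where "u = scale c x" "v = scale d x"
    by blast
  then show "u + v \<in> range (\<lambda>c. scale c x)"
    by (intro range_eqI[of _ _ "c + d"]) (simp add: scale_add_left)
next
  fix a u assume "u \<in> range (\<lambda>c. scale c x)"
  then obtain c where "u = scale c x"
    by blast
  then show "scale a u \<in> range (\<lambda>c. scale c x)"
    by (intro range_eqI[of _ _ "a * c"]) (simp add: scale_scale)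
qed

lemma linear_subspace_F_sigma: "linear_subspace Fs"
  unfolding F_sigma_eq by (rule linear_subspace_line)

lemma x_sigma_A4_set: "x_sigma \<phi> \<alpha>\<^sub>0 \<in> A4_set"
  using zero_in_vecJ by (simp add: x_sigma_def)

text \<open>The four coefficients in \<open>br_xmon\<close> are exactly the quantities that vanish
  at \<sigma>.\<close>

lemma F_sigma_central: "f \<in> Fs \<Longrightarrow> br f u = 0" "f \<in> Fs \<Longrightarrow> br u f = 0"
proof -
  show *: "br f u = 0" if "f \<in> Fs" for f
  proof (cases "f = 0")
    case True
    then show ?thesis
      using bracket2_scale_left[of \<phi> \<alpha>\<^sub>0 0 0 u] by simp
  next
    case False
    with that obtain \<sigma> c where \<sigma>: "is_sigma \<phi> \<alpha>\<^sub>0 \<sigma>" and f: "f = scale c (xmon \<sigma> 0)"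
      by (rule F_sigma_cases)
    have "br (xmon \<sigma> 0) u = 0"
      using \<sigma> by (simp add: br_xmon is_sigma_def ker_def)
    then show ?thesis
      by (simp add: f bracket2_scale_left)
  qed
  show "f \<in> Fs \<Longrightarrow> br u f = 0"
    using * by (simp add: bracket2_skew[of \<phi> \<alpha>\<^sub>0 u])
qed

lemma quot_eq: "quot u = (\<lambda>f. f + u) ` Fs"
  unfolding toB4_def a_r_coset_def' A4_eq by auto

lemma quot_mem: "v \<in> quot u \<longleftrightarrow> v - u \<in> Fs"
proof
  assume "v - u \<in> Fs"
  then show "v \<in> quot u"
    unfolding quot_eq by (rule rev_image_eqI) simp
qed (auto simp: quot_eq)

lemma quot_eq_iff: "quot u = quot v \<longleftrightarrow> u - v \<in> Fs"
proof -
  note sub = linear_subspaceD[OF linear_subspace_F_sigma]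
  show ?thesis
  proof
    assume "quot u = quot v"
    moreover have "u \<in> quot u"
      using sub(1) by (simp add: quot_mem)
    ultimately show "u - v \<in> Fs"
      by (simp add: quot_mem)
  next
    assume uv: "u - v \<in> Fs"
    have "w - u \<in> Fs \<longleftrightarrow> w - v \<in> Fs" for w
      using sub(2)[OF _ uv, of "w - u"] sub(4)[OF _ uv, of "w - v"] by auto
    then show "quot u = quot v"
      by (auto simp: quot_mem)
  qed
qed

text \<open>The unions over cosets collapse because \<open>Fs\<close> is a subspace and, for the
  bracket, because it is central.\<close>

lemma B4_sel:
  "carrier B = quot ` A4_set" "\<zero>\<^bsub>B\<^esub> = quot 0" "quot u \<oplus>\<^bsub>B\<^esub> quot v = quot (u + v)"
  "quot u \<otimes>\<^bsub>B\<^esub> quot v = quot (br u v)" "c \<odot>\<^bsub>B\<^esub> quot u = quot (scale c u)"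
proof -
  note sub = linear_subspaceD[OF linear_subspace_F_sigma]
  have self: "u \<in> quot u" for u
    using sub(1) by (simp add: quot_mem)
  show "carrier B = quot ` A4_set"
    by (auto simp: B4_def lie_quotient_def A_RCOSETS_def' toB4_def A4_eq)
  show "\<zero>\<^bsub>B\<^esub> = quot 0"
    by (simp add: B4_def lie_quotient_def quot_eq)
  have add: "quot u \<oplus>\<^bsub>B\<^esub> quot v = (\<Union>a\<in>quot u. \<Union>b\<in>quot v. {a + b})"
    by (simp add: B4_def lie_quotient_def set_add_def' A4_eq)
  show "quot u \<oplus>\<^bsub>B\<^esub> quot v = quot (u + v)"
    unfolding add
  proof (intro equalityI subsetI)
    fix w assume "w \<in> (\<Union>a\<in>quot u. \<Union>b\<in>quot v. {a + b})"
    then obtain a b where "a - u \<in> Fs" "b - v \<in> Fs" "w = a + b"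
      by (auto simp: quot_mem)
    then show "w \<in> quot (u + v)"
      using sub(2)[of "a - u" "b - v"] by (simp add: quot_mem add_diff_add)
  next
    fix w assume "w \<in> quot (u + v)"
    then have "w - v \<in> quot u"
      by (simp add: quot_mem algebra_simps)
    then show "w \<in> (\<Union>a\<in>quot u. \<Union>b\<in>quot v. {a + b})"
      using self[of v] by (intro UN_I[of "w - v"] UN_I[of v]) simp_all
  qed
  have mult: "quot u \<otimes>\<^bsub>B\<^esub> quot v = (\<Union>a\<in>quot u. \<Union>b\<in>quot v. quot (br a b))"
    unfolding toB4_def by (simp add: B4_def lie_quotient_def rcoset_mult_def A4_eq)
  have br_eq: "br a b = br u v" if "a \<in> quot u" "b \<in> quot v" for a b
  proof -
    have "br a b = br (u + (a - u)) (v + (b - v))"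
      by simp
    also have "\<dots> = br u v"
      using that unfolding quot_mem
      by (simp only: bracket2_add_left bracket2_add_right F_sigma_central add_0_right)
    finally show ?thesis .
  qed
  have "(\<Union>a\<in>quot u. \<Union>b\<in>quot v. quot (br a b)) = (\<Union>a\<in>quot u. \<Union>b\<in>quot v. quot (br u v))"
    by (intro SUP_cong refl) (simp only: br_eq)
  then show "quot u \<otimes>\<^bsub>B\<^esub> quot v = quot (br u v)"
    unfolding mult using self[of u] self[of v] by auto
  have smult: "c \<odot>\<^bsub>B\<^esub> quot u = (\<Union>a\<in>quot u. quot (scale c a))"
    unfolding toB4_def by (simp add: B4_def lie_quotient_def A4_eq)
  have smult_eq: "quot (scale c a) = quot (scale c u)" if "a \<in> quot u" for a
    using that sub(3)[of "a - u" c] by (simp add: quot_mem quot_eq_iff scale_diff_right)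
  have "(\<Union>a\<in>quot u. quot (scale c a)) = (\<Union>a\<in>quot u. quot (scale c u))"
    by (intro SUP_cong refl) (simp only: smult_eq)
  then show "c \<odot>\<^bsub>B\<^esub> quot u = quot (scale c u)"
    unfolding smult using self[of u] by auto
qed

abbreviation "F_ring \<equiv> (ring_of_type_algebra :: 'f ring)"

text \<open>
  The preimage in \<open>A\<^sub>4\<close> of the derived algebra. It is all of \<open>A\<^sub>4\<close> unless case (b) applies.
\<close>

definition derived_set :: "('g, 'f) galg set"
  where "derived_set =
    {u \<in> A4_set. \<forall>\<beta>. star \<beta> \<longrightarrow> vecJ J = {0} \<longrightarrow> Poly_Mapping.lookup u (\<beta>, 0) = 0}"

section \<open>The derived algebra and simplicity\<close>

lemma derived_set_A4_set: "derived_set \<subseteq> A4_set"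
  by (auto simp: derived_set_def)

lemma linear_subspace_derived_set: "linear_subspace derived_set"
  using linear_subspace_A4_set unfolding linear_subspace_def derived_set_def
  by (simp add: lookup_add lookup_scale)

text \<open>A bracket of two monomials has two terms, each with a 2 by 2 determinant as coefficient.
  If a term sits at x^\<rho>, \<open>star \<rho>\<close> makes the two rows of its determinant
  opposite, so it vanishes.\<close>

lemma bracket_in_derived_set:
  assumes "u \<in> A4_set" "v \<in> A4_set"
  shows "br u v \<in> derived_set"
proof -
  have "Poly_Mapping.lookup (br u v) (\<rho>, 0) = 0" if \<rho>: "star \<rho>" and J0: "vecJ J = {0}" for \<rho>
  proof -
    have mon: "Poly_Mapping.lookup (br (xmon \<alpha> 0) (xmon \<beta> 0)) (\<rho>, 0) = 0" for \<alpha> \<beta>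
    proof -
      let ?\<omega> = "\<phi> 1 \<alpha> * \<phi> 2 \<beta> - \<phi> 2 \<alpha> * \<phi> 1 \<beta>"
      let ?\<eta> = "(\<phi> 3 \<alpha> + \<phi> 3 \<alpha>\<^sub>0) * (\<phi> 4 \<beta> + \<phi> 4 \<alpha>\<^sub>0) - (\<phi> 4 \<alpha> + \<phi> 4 \<alpha>\<^sub>0) * (\<phi> 3 \<beta> + \<phi> 3 \<alpha>\<^sub>0)"
      have br: "br (xmon \<alpha> 0) (xmon \<beta> 0)
          = scale ?\<omega> (xmon (\<alpha> + (\<alpha>\<^sub>0 + \<beta>)) 0) + scale ?\<eta> (xmon (\<alpha> + \<beta>) 0)"
        by (simp add: br_xmon D_xmon E_xmon scale_scale distrib_left right_diff_distrib
            scale_mult_right xmon_shift scale_diff_left)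
      have "?\<omega> = 0" if "\<alpha> + (\<alpha>\<^sub>0 + \<beta>) = \<rho>"
      proof -
        have "\<phi> p \<alpha> = - \<phi> p \<beta>" if "p \<in> {1, 2}" for p
          using \<rho> that \<open>\<alpha> + (\<alpha>\<^sub>0 + \<beta>) = \<rho>\<close>[symmetric]
          by (auto simp: star_cond_def eq_neg_iff_add_eq_0)
        then show ?thesis by simp
      qed
      moreover have "?\<eta> = 0" if "\<alpha> + \<beta> = \<rho>"
      proof -
        have "\<phi> p \<beta> + \<phi> p \<alpha>\<^sub>0 = - (\<phi> p \<alpha> + \<phi> p \<alpha>\<^sub>0)" if "p \<in> {3, 4}" for p
          using \<rho> that \<open>\<alpha> + \<beta> = \<rho>\<close>[symmetric]
          by (auto simp: star_cond_def eq_neg_iff_add_eq_0 algebra_simps)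
        from this[of 3] this[of 4] show ?thesis
          by (simp only: insertI1 insertI2 simp_thms mult_minus_left mult_minus_right mult.commute diff_self)
      qed
      ultimately show ?thesis
        by (simp add: br lookup_add lookup_scale lookup_single when_def)
    qed
    have keys: "Poly_Mapping.keys u \<subseteq> UNIV \<times> {0}" "Poly_Mapping.keys v \<subseteq> UNIV \<times> {0}"
      using assms J0 by auto
    have lin0: "br 0 w = 0" "br w 0 = 0" for w
      using bracket2_scale_left[of \<phi> \<alpha>\<^sub>0 0 0 w] bracket2_scale_right[of \<phi> \<alpha>\<^sub>0 w 0 0] by simp_all
    have mon_v: "Poly_Mapping.lookup (br (xmon \<alpha> 0) v) (\<rho>, 0) = 0" for \<alpha>
      using keys(2) by (induction v rule: galg_span_induct)
        (auto simp: mon lin0 bracket2_add_right bracket2_scale_right lookup_add lookup_scale)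
    show ?thesis
      using keys(1) by (induction u rule: galg_span_induct)
        (auto simp: mon_v lin0 bracket2_add_left bracket2_scale_left lookup_add lookup_scale)
  qed
  then show ?thesis
    using bracket_A4_set[OF assms] by (simp add: derived_set_def)
qed

lemma derived_set_subset:
  assumes I: "linear_subspace I"
    and mon: "\<And>\<beta> i. i \<in> vecJ J \<Longrightarrow> \<not> star \<beta> \<or> vecJ J \<noteq> {0} \<Longrightarrow> xmon \<beta> i \<in> I"
  shows "derived_set \<subseteq> I"
proof
  fix u assume u: "u \<in> derived_set"
  have "Poly_Mapping.keys u \<subseteq> {(\<beta>, i). i \<in> vecJ J \<and> (\<not> star \<beta> \<or> vecJ J \<noteq> {0})}"
  proof
    fix k assume k: "k \<in> Poly_Mapping.keys u"
    obtain \<beta> i where \<beta>: "k = (\<beta>, i)" by (cases k)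
    have i: "i \<in> vecJ J"
      using u k \<beta> unfolding derived_set_def by blast
    moreover have "\<not> star \<beta>" if "vecJ J = {0}"
      using u k i that unfolding \<beta> derived_set_def by (auto simp: in_keys_iff)
    ultimately show "k \<in> {(\<beta>, i). i \<in> vecJ J \<and> (\<not> star \<beta> \<or> vecJ J \<noteq> {0})}"
      by (auto simp: \<beta>)
  qed
  then show "u \<in> I"
  proof (induction u rule: galg_span_induct)
    case (scale c \<alpha> i)
    then show ?case
      using mon linear_subspaceD(3)[OF I] by blast
  qed (use linear_subspaceD[OF I] in blast)+
qed

lemma quot_surjection:
  assumes U: "linear_subspace U" and closed: "\<And>u v. u \<in> U \<Longrightarrow> v \<in> U \<Longrightarrow> br u v \<in> U"
  shows "lie_surjection F_ring (lie_on \<phi> \<alpha>\<^sub>0 U) (B\<lparr>carrier := quot ` U\<rparr>) quot"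
  by (rule lie_surjection.intro[OF lie_algebra_lie_on[OF additive U closed]]) (simp_all add: B4_sel)

lemma quot_zero_iff: "quot u = \<zero>\<^bsub>B\<^esub> \<longleftrightarrow> u \<in> Fs"
  by (simp add: B4_sel(2) quot_eq_iff)

text \<open>The element 1 is not in \<open>Fs\<close>, since \<sigma> = 0 would contradict
  \<open>alpha0_34\<close>. A bracket with 1 can thus be made nonzero with generic weights.\<close>

lemma nonzero_bracket: "\<exists>u\<in>derived_set. \<exists>v\<in>derived_set. br u v \<notin> Fs"
proof -
  have one: "xmon 0 0 \<in> derived_set"
    using zero_in_vecJ not_star12[of 0]
    by (auto simp: derived_set_def lookup_single when_def)
  have "xmon 0 0 \<notin> Fs"
  proof
    assume "xmon 0 0 \<in> Fs"
    moreover have "(xmon 0 0 :: ('g, 'f) galg) \<noteq> 0"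
      by (metis lookup_single_eq lookup_zero zero_neq_one)
    ultimately obtain \<sigma> c where \<sigma>: "is_sigma \<phi> \<alpha>\<^sub>0 \<sigma>" "(xmon 0 0 :: ('g, 'f) galg) = scale c (xmon \<sigma> 0)"
      by (rule F_sigma_cases)
    then have "Poly_Mapping.lookup (scale c (xmon \<sigma> 0)) (0, 0) = 1"
      by (simp flip: \<sigma>(2))
    then have "\<sigma> = 0"
      by (auto simp: lookup_scale lookup_single when_def split: if_splits)
    with \<sigma>(1) show False
      using alpha0_34 by (auto simp: is_sigma_def)
  qed
  note not_sigma = not_in_F_sigma[OF this]
  obtain \<alpha> where \<alpha>: "\<not> star \<alpha>" "br (xmon \<alpha> 0) (xmon 0 0) \<noteq> 0"
      "weights (br (xmon \<alpha> 0) (xmon 0 0)) \<subseteq> generic"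
    using generic_bracket[OF not_sigma] by blast
  have "br (xmon \<alpha> 0) (xmon 0 0) \<notin> Fs"
  proof
    assume "br (xmon \<alpha> 0) (xmon 0 0) \<in> Fs"
    then obtain \<sigma> c where \<sigma>: "is_sigma \<phi> \<alpha>\<^sub>0 \<sigma>" "br (xmon \<alpha> 0) (xmon 0 0) = scale c (xmon \<sigma> 0)"
      using \<alpha>(2) by (rule F_sigma_cases)
    \<comment> \<open>\<open>D 1\<close> kills \<open>Fs\<close>, whereas 0 is not a generic
      eigenvalue.\<close>
    have "D 1 (br (xmon \<alpha> 0) (xmon 0 0)) = scale 0 (br (xmon \<alpha> 0) (xmon 0 0))"
      using \<sigma>(1) unfolding \<sigma>(2) by (simp add: partial_scale D_xmon is_sigma_def ker_def)
    from generic_eigenvalue[OF \<alpha>(3,2) this] show False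
      by simp
  qed
  moreover have "xmon \<alpha> 0 \<in> derived_set"
    using zero_in_vecJ \<alpha>(1) by (auto simp: derived_set_def lookup_single when_def)
  ultimately show ?thesis
    using one by blast
qed

lemma xmon_not_star: "\<not> star \<alpha> \<Longrightarrow> i \<in> vecJ J \<Longrightarrow> xmon \<alpha> i \<in> derived_set"
  by (auto simp: derived_set_def lookup_single when_def)

lemma derived_set_subset_ad_stable:
  assumes I: "ad_stable I" and u: "u \<in> I" "u \<notin> Fs"
  shows "derived_set \<subseteq> I"
  by (rule derived_set_subset[OF ad_stableD(1)[OF I]])
    (rule monomials_in_ad_stable[OF I u(1) not_in_F_sigma[OF u(2)]])

lemma lie_algebra_derived_set: "lie_algebra F_ring (lie_on \<phi> \<alpha>\<^sub>0 derived_set)"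
  by (rule lie_algebra_lie_on[OF additive linear_subspace_derived_set])
    (use bracket_in_derived_set derived_set_A4_set in blast)

text \<open>This serves both cases: \<open>quot\<close> applied to \<open>derived_set\<close> gives
  the derived algebra in general, and all of \<open>B\<close> in case (a).\<close>

lemma simple_derived: "simple_lie_algebra F_ring (B\<lparr>carrier := quot ` derived_set\<rparr>)"
proof -
  interpret L: lie_algebra F_ring "lie_on \<phi> \<alpha>\<^sub>0 derived_set"
    by (rule lie_algebra_derived_set)
  interpret S: lie_surjection F_ring "lie_on \<phi> \<alpha>\<^sub>0 derived_set" "B\<lparr>carrier := quot ` derived_set\<rparr>" quot
    by (rule quot_surjection[OF linear_subspace_derived_set])
      (use bracket_in_derived_set derived_set_A4_set in blast)
  obtain x y where xy: "x \<in> derived_set" "y \<in> derived_set" "br x y \<notin> Fs"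
    using nonzero_bracket by blast
  show ?thesis
  proof (rule S.simple_target[of x y])
    fix I
    assume ideal: "lie_ideal F_ring (lie_on \<phi> \<alpha>\<^sub>0 derived_set) I"
    have "ad_stable I"
      using ideal xmon_not_star
      unfolding lie_ideal_def L.submodule_iff ad_stable_def linear_subspace_def by auto
    moreover have "I \<subseteq> derived_set"
      using ideal unfolding lie_ideal_def L.submodule_iff by simp
    ultimately show "I \<subseteq> {x \<in> carrier (lie_on \<phi> \<alpha>\<^sub>0 derived_set).
          quot x = \<zero>\<^bsub>B\<lparr>carrier := quot ` derived_set\<rparr>\<^esub>} \<or> I = carrier (lie_on \<phi> \<alpha>\<^sub>0 derived_set)"
      using derived_set_subset_ad_stable[of I] by (auto simp: quot_zero_iff)
  qed (use xy in \<open>simp_all add: quot_zero_iff\<close>)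
qed

lemma quot_surjection_A4: "lie_surjection F_ring (lie_on \<phi> \<alpha>\<^sub>0 A4_set) B quot"
  using quot_surjection[OF linear_subspace_A4_set bracket_A4_set] by (simp flip: B4_sel(1))

text \<open>A submodule containing all brackets has an \<open>ad_stable\<close> preimage, which
  contains a bracket outside \<open>Fs\<close> and hence \<open>derived_set\<close>.\<close>

lemma derived_space_B4: "derived_space F_ring B = quot ` derived_set"
proof -
  interpret S: lie_surjection F_ring "lie_on \<phi> \<alpha>\<^sub>0 A4_set" B quot
    by (rule quot_surjection_A4)
  interpret A: lie_algebra F_ring "lie_on \<phi> \<alpha>\<^sub>0 A4_set"
    by (rule S.lie)
  interpret B: lie_algebra F_ring B
    by (rule S.lie_algebra_target)
  have sub: "submodule derived_set F_ring (lie_on \<phi> \<alpha>\<^sub>0 A4_set)"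
    unfolding A.submodule_iff
    using linear_subspaceD[OF linear_subspace_derived_set] derived_set_A4_set by auto
  let ?S = "{x \<otimes>\<^bsub>B\<^esub> y | x y. x \<in> carrier B \<and> y \<in> carrier B}"
  have "?S \<subseteq> quot ` derived_set"
    by (auto simp: B4_sel intro!: imageI bracket_in_derived_set)
  moreover have "quot ` derived_set \<subseteq> H" if H: "submodule H F_ring B" "?S \<subseteq> H" for H
  proof -
    define I where "I = {x \<in> A4_set. quot x \<in> H}"
    have br_in: "br x y \<in> I" if "x \<in> A4_set" "y \<in> A4_set" for x y
    proof -
      have "quot x \<otimes>\<^bsub>B\<^esub> quot y \<in> H"
        by (rule subsetD[OF H(2)], unfold B4_sel(1)) (use that in blast)
      then show ?thesis
        using that bracket_A4_set by (simp add: I_def B4_sel)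
    qed
    have "linear_subspace I"
      using S.submodule_preimage[OF H(1)] unfolding A.submodule_iff linear_subspace_def
      by (simp add: I_def)
    then have "ad_stable I"
      using br_in xmon_A4_set unfolding ad_stable_def by (auto simp: I_def)
    moreover obtain x y where "x \<in> derived_set" "y \<in> derived_set" "br x y \<notin> Fs"
      using nonzero_bracket by blast
    ultimately have "derived_set \<subseteq> I"
      using derived_set_subset_ad_stable[of I "br x y"] br_in derived_set_A4_set by blast
    then show ?thesis
      by (auto simp: I_def)
  qed
  ultimately show ?thesis
    using S.submodule_image[OF sub] unfolding derived_space_def hull_def by blast
qed

lemma star_unique:
  assumes "star \<beta>" "star \<rho>"
  shows "\<beta> = \<rho>"
proof (rule weight_eqI)
  fix p
  have "\<phi> p \<beta> + d_shift p = 0" "\<phi> p \<rho> + d_shift p = 0"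
    using assms by (simp_all add: star_iff_d_shift)
  then show "\<phi> p \<beta> = \<phi> p \<rho>"
    by (metis add_right_cancel)
qed

text \<open>The complement is read off from the coefficient at x^\<rho>, which is well defined on
  cosets because \<sigma> and \<rho> differ.\<close>

lemma direct_sum_derived:
  assumes J0: "vecJ J = {0}" and \<rho>: "star \<rho>"
  shows "is_direct_sum F_ring B (derived_space F_ring B)
    (line F_ring B (quot (xmon \<rho> 0)) <+>\<^bsub>B\<^esub> line F_ring B (quot (x_sigma \<phi> \<alpha>\<^sub>0)))"
proof -
  interpret S: lie_surjection F_ring "lie_on \<phi> \<alpha>\<^sub>0 A4_set" B quot
    by (rule quot_surjection_A4)
  interpret A: lie_algebra F_ring "lie_on \<phi> \<alpha>\<^sub>0 A4_set"
    by (rule S.lie)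
  define W where "W = range (\<lambda>c. scale c (xmon \<rho> 0 :: ('g, 'f) galg))"
  have line: "line F_ring B (quot v) = quot ` range (\<lambda>c. scale c v)" for v
    by (auto simp: line_def B4_sel)
  have x\<sigma>: "quot (scale c (x_sigma \<phi> \<alpha>\<^sub>0)) = quot 0" for c
    unfolding quot_eq_iff F_sigma_eq by simp
  have W: "line F_ring B (quot (xmon \<rho> 0)) <+>\<^bsub>B\<^esub> line F_ring B (quot (x_sigma \<phi> \<alpha>\<^sub>0)) = quot ` W"
  proof -
    have "line F_ring B (quot (x_sigma \<phi> \<alpha>\<^sub>0)) = {quot 0}"
      unfolding line image_image x\<sigma> by simp
    moreover have "quot u \<oplus>\<^bsub>B\<^esub> quot 0 = quot u" for u
      by (simp only: B4_sel(3) add_0_right)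
    ultimately show ?thesis
      unfolding line[of "xmon \<rho> 0"] W_def[symmetric] set_add_def' by auto
  qed
  have W_A4: "W \<subseteq> A4_set"
    unfolding W_def using linear_subspaceD(3)[OF linear_subspace_A4_set xmon_A4_set] zero_in_vecJ by blast
  have "linear_subspace W"
    unfolding W_def by (rule linear_subspace_line)
  then have "submodule W F_ring (lie_on \<phi> \<alpha>\<^sub>0 A4_set)"
    unfolding A.submodule_iff linear_subspace_def using W_A4 by auto
  note W_sub = S.submodule_image[OF this]
  have "submodule derived_set F_ring (lie_on \<phi> \<alpha>\<^sub>0 A4_set)"
    unfolding A.submodule_iff
    using linear_subspaceD[OF linear_subspace_derived_set] derived_set_A4_set by auto
  note D_sub = S.submodule_image[OF this]
  have star_eq: "\<beta> = \<rho>" if "star \<beta>" for \<beta>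
    using that \<rho> by (rule star_unique)
  have sum: "quot ` derived_set <+>\<^bsub>B\<^esub> quot ` W = carrier B"
  proof
    show "quot ` derived_set <+>\<^bsub>B\<^esub> quot ` W \<subseteq> carrier B"
    proof
      fix x assume "x \<in> quot ` derived_set <+>\<^bsub>B\<^esub> quot ` W"
      then obtain u w where "u \<in> derived_set" "w \<in> W" "x = quot (u + w)"
        unfolding set_add_def' by (auto simp: B4_sel(3))
      moreover from this have "u + w \<in> A4_set"
        using derived_set_A4_set W_A4 by (intro linear_subspaceD(2)[OF linear_subspace_A4_set]) blast+
      ultimately show "x \<in> carrier B"
        unfolding B4_sel by blast
    qed
    show "carrier B \<subseteq> quot ` derived_set <+>\<^bsub>B\<^esub> quot ` W"
    proof
      fix x assume "x \<in> carrier B"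
      then obtain u where u: "u \<in> A4_set" "x = quot u"
        unfolding B4_sel by blast
      \<comment> \<open>Removing the x^\<rho> term is the projection onto
        \<open>derived_set\<close>.\<close>
      define w where "w = scale (Poly_Mapping.lookup u (\<rho>, 0)) (xmon \<rho> 0 :: ('g, 'f) galg)"
      have w: "w \<in> W"
        by (simp add: w_def W_def)
      have "u - w \<in> A4_set"
        by (rule linear_subspaceD(4)[OF linear_subspace_A4_set u(1)]) (use w W_A4 in blast)
      moreover have "Poly_Mapping.lookup (u - w) (\<rho>, 0) = 0"
        by (simp add: lookup_minus w_def lookup_scale)
      ultimately have "u - w \<in> derived_set"
        using star_eq unfolding derived_set_def by blast
      moreover have "x = quot (u - w) \<oplus>\<^bsub>B\<^esub> quot w"
        by (simp add: B4_sel u)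
      ultimately show "x \<in> quot ` derived_set <+>\<^bsub>B\<^esub> quot ` W"
        using w unfolding set_add_def' by blast
    qed
  qed
  have "x = \<zero>\<^bsub>B\<^esub>" if "x \<in> quot ` derived_set" "x \<in> quot ` W" for x
  proof -
    obtain u c where u: "u \<in> derived_set" "x = quot u" "x = quot (scale c (xmon \<rho> 0))"
      using \<open>x \<in> quot ` derived_set\<close> \<open>x \<in> quot ` W\<close> unfolding W_def by blast
    have \<sigma>0: "Poly_Mapping.lookup f (\<rho>, 0) = 0" if "f \<in> Fs" for f
    proof (cases "f = 0")
      case False
      with that obtain \<sigma> d where \<sigma>: "is_sigma \<phi> \<alpha>\<^sub>0 \<sigma>" "f = scale d (xmon \<sigma> 0)"
        by (rule F_sigma_cases)
      then have "\<sigma> \<noteq> \<rho>"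
        using not_star12[of \<sigma>] \<rho> by (auto simp: is_sigma_def ker_def)
      then show ?thesis
        by (simp add: \<sigma>(2) lookup_scale lookup_single when_def)
    qed simp
    have "u - scale c (xmon \<rho> 0) \<in> Fs"
      using u quot_eq_iff by metis
    from \<sigma>0[OF this] have "Poly_Mapping.lookup u (\<rho>, 0) = c"
      by (simp add: lookup_minus lookup_scale)
    moreover have "Poly_Mapping.lookup u (\<rho>, 0) = 0"
      using u(1) \<rho> J0 by (simp add: derived_set_def)
    ultimately show ?thesis
      using u(3) by (simp add: B4_sel)
  qed
  moreover have "\<zero>\<^bsub>B\<^esub> \<in> quot ` derived_set" "\<zero>\<^bsub>B\<^esub> \<in> quot ` W"
    unfolding B4_sel
    using linear_subspaceD(1)[OF linear_subspace_derived_set] linear_subspaceD(1)[OF \<open>linear_subspace W\<close>]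
    by blast+
  ultimately have "quot ` derived_set \<inter> quot ` W = {\<zero>\<^bsub>B\<^esub>}"
    by blast
  then show ?thesis
    unfolding is_direct_sum_def derived_space_B4 W using D_sub W_sub sum by blast
qed

text \<open>In case (a) the coefficient condition in \<open>derived_set\<close> is vacuous.\<close>

lemma simple_B4:
  assumes "vecJ J \<noteq> {0} \<or> \<not> (\<exists>\<rho>. star \<rho>)"
  shows "simple_lie_algebra F_ring B"
proof -
  have "derived_set = A4_set"
    using assms unfolding derived_set_def by blast
  with simple_derived show ?thesis
    by (simp flip: B4_sel(1))
qed

end

theorem theorem2:
  fixes J :: "4 \<Rightarrow> nat set"
    and \<phi> :: "4 \<Rightarrow> 'g::ab_group_add \<Rightarrow> 'f::field_char_0"
    and \<alpha>\<^sub>0 :: 'g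
  assumes torsion_free: "torsion_free TYPE('g)"
    and J: "\<And>p. J p = {0} \<or> J p = UNIV"
    and additive: "\<And>p. additive (\<phi> p)"
    and nonzero: "\<And>p. J p = {0} \<Longrightarrow> \<phi> p \<noteq> (\<lambda>_. 0)"
    and ker_all: "(\<Inter>p. ker (\<phi> p)) = {0}"
    and ker_but_one: "\<And>p. (\<Inter>q\<in>UNIV - {p}. ker (\<phi> q)) - ker (\<phi> p) \<noteq> {}"
    and \<alpha>\<^sub>0: "\<alpha>\<^sub>0 \<notin> (ker (\<phi> 1) \<inter> ker (\<phi> 2)) \<union> (ker (\<phi> 3) \<inter> ker (\<phi> 4))"
    and \<alpha>\<^sub>0_12: "\<And>p. p \<in> {1, 2} \<Longrightarrow> \<phi> p \<alpha>\<^sub>0 \<in> \<phi> p ` (ker (\<phi> 3) \<inter> ker (\<phi> 4))"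
    and \<alpha>\<^sub>0_34: "\<And>q. q \<in> {3, 4} \<Longrightarrow> \<phi> q \<alpha>\<^sub>0 \<in> \<phi> q ` (ker (\<phi> 1) \<inter> ker (\<phi> 2))"
  shows "(vecJ J \<noteq> {0} \<or> \<not> (\<exists>\<rho>. star_cond \<phi> \<alpha>\<^sub>0 \<rho>) \<longrightarrow>
            simple_lie_algebra ring_of_type_algebra (B4 J \<phi> \<alpha>\<^sub>0))
       \<and> (\<forall>\<rho>. vecJ J = {0} \<and> star_cond \<phi> \<alpha>\<^sub>0 \<rho> \<longrightarrow>
            (\<forall>\<rho>'. star_cond \<phi> \<alpha>\<^sub>0 \<rho>' \<longrightarrow> \<rho>' = \<rho>) \<and>
            simple_lie_algebra ring_of_type_algebra
              (derived_algebra ring_of_type_algebra (B4 J \<phi> \<alpha>\<^sub>0)) \<and>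
            is_direct_sum ring_of_type_algebra (B4 J \<phi> \<alpha>\<^sub>0)
              (derived_space ring_of_type_algebra (B4 J \<phi> \<alpha>\<^sub>0))
              (line ring_of_type_algebra (B4 J \<phi> \<alpha>\<^sub>0) (toB4 J \<phi> \<alpha>\<^sub>0 (xmon \<rho> 0))
               <+>\<^bsub>B4 J \<phi> \<alpha>\<^sub>0\<^esub>
               line ring_of_type_algebra (B4 J \<phi> \<alpha>\<^sub>0) (toB4 J \<phi> \<alpha>\<^sub>0 (x_sigma \<phi> \<alpha>\<^sub>0))))"
proof -
  interpret w_type_data J \<phi> \<alpha>\<^sub>0
    by (rule w_type_data.intro[OF J additive ker_all ker_but_one \<alpha>\<^sub>0])
  have "\<rho>' = \<rho>" if "star_cond \<phi> \<alpha>\<^sub>0 \<rho>" "star_cond \<phi> \<alpha>\<^sub>0 \<rho>'" for \<rho> \<rho>'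
    by (rule star_unique[OF that(2,1)])
  then show ?thesis
    using simple_B4 simple_derived direct_sum_derived by (simp add: derived_space_B4)
qed

end
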